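(* There are absolute constants $C_1,C_2>0$ such that the following holds. Write $N=2^n=|\mathbb{Z}_2^n|$, let $A$ be a uniformly random subset of $\mathbb{Z}_2^n$ (each of the $2^N$ subsets being equally likely), and let $\omega(G_A)$ be the clique number of the Cayley sum graph $G_A$. Then $$\lim_{n\to\infty}\mathbb{P}\left(C_1\log N\log\log N\le\omega(G_A)\le C_2\log N\log\log N\right)=1.$$
   Context: $\mathbb{Z}_2=\mathbb{Z}/2\mathbb{Z}$. For a finite abelian group $\Gamma$ and $A\subseteq\Gamma$, the Cayley sum graph $G_A$ is the (simple) graph on vertex set $\Gamma$ in which distinct $i,j$ are joined by an edge precisely when $i+j\in A$. The clique number $\omega$ is the largest number of vertices in a complete subgraph. All logarithms are to base 2. *)

theory Defs
  imports
    "HOL-Probability.Probability"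
    "HOL-Library.Ramsey"
    "HOL-Algebra.Product_Groups"
begin

text \<open>
  Groups are written multiplicatively in HOL-Algebra, so the sum \<open>i + j\<close> in the group \<open>\<Gamma>\<close>
  appears as \<open>i \<otimes>\<^bsub>\<Gamma>\<^esub> j\<close>.  A simple graph is a set of vertices together with a set of
  two-element edges \<open>{i, j}\<close>, as in the definition of \<^const>\<open>clique\<close> in HOL-Library.  Since an
  edge is an unordered pair, the edge set below is meant for abelian \<open>\<Gamma>\<close>.
\<close>

definition cayley_sum_edges :: "('a, 'b) monoid_scheme \<Rightarrow> 'a set \<Rightarrow> 'a set set" where
  "cayley_sum_edges \<Gamma> A =
     {{i, j} | i j. i \<in> carrier \<Gamma> \<and> j \<in> carrier \<Gamma> \<and> i \<noteq> j \<and> i \<otimes>\<^bsub>\<Gamma>\<^esub> j \<in> A}"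

definition clique_number :: "'a set \<Rightarrow> 'a set set \<Rightarrow> nat" where
  "clique_number V E = Max {card K | K. K \<subseteq> V \<and> clique K E}"

definition Z2_pow :: "nat \<Rightarrow> (nat \<Rightarrow> int) monoid" where
  "Z2_pow n = product_group {..<n} (\<lambda>_. integer_mod_group 2)"

lemma comm_group_Z2_pow: "comm_group (Z2_pow n)"
  unfolding Z2_pow_def
  by (rule group.group_comm_groupI) (auto simp: add.commute intro!: restrict_ext)

lemma order_Z2_pow: "order (Z2_pow n) = 2 ^ n"
  by (simp add: order_def Z2_pow_def carrier_integer_mod_group card_PiE)

lemma finite_carrier_Z2_pow: "finite (carrier (Z2_pow n))"
  by (simp add: Z2_pow_def carrier_integer_mod_group finite_PiE)

lemma clique_cayley_sum_edges_iff:
  assumes "comm_group \<Gamma>" "K \<subseteq> carrier \<Gamma>"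
  shows "clique K (cayley_sum_edges \<Gamma> A) \<longleftrightarrow> (\<forall>i\<in>K. \<forall>j\<in>K. i \<noteq> j \<longrightarrow> i \<otimes>\<^bsub>\<Gamma>\<^esub> j \<in> A)"
proof -
  interpret comm_group \<Gamma> by fact
  have "{i, j} \<in> cayley_sum_edges \<Gamma> A \<longleftrightarrow> i \<otimes>\<^bsub>\<Gamma>\<^esub> j \<in> A"
    if "i \<in> K" "j \<in> K" "i \<noteq> j" for i j
    using that assms(2) unfolding cayley_sum_edges_def
    by (auto simp: doubleton_eq_iff subset_iff m_comm)
  then show ?thesis
    unfolding clique_def by auto
qed

definition random_subset :: "'a set \<Rightarrow> 'a set pmf" where
  "random_subset S = pmf_of_set (Pow S)"

end

theory Submission
  imports
    Defs
    "HOL-Library.Z2"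
    "HOL-Library.Function_Algebras"
    "HOL-Library.Set_Algebras"
    "HOL-Real_Asymp.Real_Asymp"
begin

text \<open>
In a group of exponent two distinct elements have nonzero sum, so a set \<open>K\<close> is a clique exactly when
\<open>K + K - {0} \<subseteq> A\<close>.  A fixed nonempty \<open>K\<close> is therefore a clique with probability
\<open>2 powr (1 - card (K + K))\<close>, and the clique number is governed by how many sets have a sumset of a given
size.  Write \<open>lg\<close> for the binary logarithm of \<open>n\<close>.

\<^emph>\<open>Lower bound.\<close> A subspace of dimension \<open>k\<close> is a clique with probability \<open>2 powr (1 - 2 ^ k)\<close>, and there are
about \<open>2 ^ (k * (n - k))\<close> of them.  So the expected number of cliques of this kind is large as long as \<open>2 ^ k\<close> is
at most a small multiple of \<open>n * k\<close>, which allows \<open>2 ^ k\<close> to be of order \<open>n * lg\<close>.  The second moment method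
(\<open>prob_no_superset_le\<close>) turns this into existence, provided that two random subspaces rarely meet in a
large subspace.  The subspaces used are graphs of linear maps from the first \<open>k\<close> coordinates to the
remaining ones: two graphs meet in the kernel of the difference of the maps, and a random map has a kernel of
dimension \<open>d\<close> with probability at most \<open>2 ^ ((k + 1) * d)\<close> divided by \<open>2 ^ ((n - k) * d)\<close>
(\<open>card_tuples_with_nullspace\<close>).

\<^emph>\<open>Upper bound.\<close> A union bound over all sets of size \<open>m\<close> fails, because there are too many of them.  Instead
every \<open>K\<close> with \<open>m\<close> elements is assigned a witness inside \<open>K\<close>, and the witnesses with a sumset of size \<open>q\<close> are
few enough, at most \<open>2 powr (q / 2)\<close> for each rank.  Two ingredients make this work.

Growing a set \<open>S\<close> inside \<open>K\<close> from a basis of \<open>K\<close>, one adds an element whenever more than half of its sums with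
\<open>S\<close> are new.  Each step enlarges \<open>S + S\<close> by about half the size of \<open>S\<close>, so the process stops after about
\<open>2 * sqrt q\<close> steps, and then every element of \<open>K\<close> is \<^emph>\<open>popular\<close>: at least half of its sums with \<open>S\<close> lie in \<open>S + S\<close>.
At most \<open>2 * card (S + S)\<close> vectors are popular (\<open>greedy_skeleton\<close>, \<open>popular_bound\<close>).  If \<open>K\<close> has
rank \<open>r\<close>, such a skeleton \<open>S\<close> is described by \<open>r\<close> vectors of the whole space and \<open>2 * sqrt q\<close> vectors of their
span, hence by \<open>n * r + 2 * r * sqrt q\<close> bits.

For small rank, below a constant times \<open>lg\<close>, the witness is \<open>S\<close> itself: its sumset has at least \<open>m / 2\<close> elements,
which exceeds the description length when \<open>m\<close> is a large multiple of \<open>n * lg\<close>.  For larger rank the witness is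
\<open>K\<close>, described by \<open>S\<close> together with an \<open>m\<close>-element subset of the popular vectors.  Here the edge-isoperimetric
inequality in the cube gives \<open>m * r \<le> 2 * q * log 2 (2 * q)\<close> (\<open>rank_doubling\<close>), so \<open>q\<close> is at least a
large multiple of \<open>n * r\<close> and of \<open>m\<close>, and both parts of the description are short compared with \<open>q\<close>.
\<close>

section \<open>Vectors over the field with two elements\<close>

text \<open>
These rewrite rules would replace the field operations on bits by bit operations, and so hide the vector space
structure.
\<close>

declare add_bit_eq_xor [simp del] mult_bit_eq_and [simp del]

type_synonym bitvec = "nat \<Rightarrow> bit"

definition scale_bitvec :: "bit \<Rightarrow> bitvec \<Rightarrow> bitvec" where
  "scale_bitvec c v = (\<lambda>i. c * v i)"

interpretation bitvec: vector_space scale_bitvec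
  by unfold_locales
     (simp_all only: scale_bitvec_def fun_eq_iff plus_fun_apply distrib_left distrib_right
       mult.assoc mult_1 simp_thms)

lemma bitvec_add_self [simp]: "x + x = 0" for x :: bitvec
proof
  show "(x + x) i = 0 i" for i by (cases "x i") simp_all
qed

lemma bitvec_minus_eq_plus: "x - y = x + y" for x y :: bitvec
  by (simp add: fun_eq_iff)

lemma bitvec_add_eq_iff: "x + y = z \<longleftrightarrow> x = z + y" for x y z :: bitvec
  by (auto simp: add.assoc)

text \<open>
All vector spaces \<open>\<int>\<^sub>2\<^sup>n\<close> live inside one type, so that the dimension is an ordinary number and a
low-dimensional space is a subset of a higher-dimensional one.
\<close>

definition cube :: "nat \<Rightarrow> bitvec set" where
  "cube n = {v. \<forall>i\<ge>n. v i = 0}"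

lemma cube_zero [simp]: "0 \<in> cube n"
  by (simp add: cube_def)

lemma cube_add [simp]: "u \<in> cube n \<Longrightarrow> v \<in> cube n \<Longrightarrow> u + v \<in> cube n"
  by (simp add: cube_def)

lemma cube_0: "cube 0 = {0}"
  by (auto simp: cube_def fun_eq_iff)

lemma cube_Suc: "cube (Suc n) = cube n \<union> (\<lambda>v. v(n := 1)) ` cube n"
proof (intro equalityI subsetI)
  fix v assume v: "v \<in> cube (Suc n)"
  show "v \<in> cube n \<union> (\<lambda>v. v(n := 1)) ` cube n"
  proof (cases "v n")
    case zero
    then have "v \<in> cube n"
      using v unfolding cube_def by (auto simp: le_Suc_eq) (metis Suc_leI le_neq_implies_less)
    then show ?thesis by simp
  next
    case one
    then have "v = (v(n := 0))(n := 1)" by (auto simp: fun_eq_iff)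
    moreover have "v(n := 0) \<in> cube n"
      using v by (auto simp: cube_def)
    ultimately show ?thesis by blast
  qed
qed (auto simp: cube_def)

lemma cube_Suc_disjoint: "cube n \<inter> (\<lambda>v. v(n := 1)) ` cube n = {}"
  by (auto simp: cube_def)

lemma inj_on_cube_upd: "inj_on (\<lambda>v. v(n := 1)) (cube n)"
  by (auto simp: inj_on_def cube_def fun_eq_iff) (metis le_refl)

lemma card_cube: "finite (cube n) \<and> card (cube n) = 2 ^ n"
proof (induction n)
  case 0
  then show ?case by (simp add: cube_0)
next
  case (Suc n)
  then show ?case
    by (simp add: cube_Suc card_Un_disjoint cube_Suc_disjoint card_image[OF inj_on_cube_upd])
qed

lemmas finite_cube [simp] = card_cube[THEN conjunct1]

lemma card_span_le:
  assumes "finite B"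
  shows "finite (bitvec.span B)" "card (bitvec.span B) \<le> 2 ^ card B"
proof -
  have sub: "bitvec.span B \<subseteq> (\<lambda>S. \<Sum>S) ` Pow B"
  proof
    fix x assume "x \<in> bitvec.span B"
    then obtain u where x: "x = (\<Sum>v\<in>B. scale_bitvec (u v) v)"
      using bitvec.span_finite[OF assms] by auto
    also have "\<dots> = (\<Sum>v\<in>B. if u v = 1 then v else 0)"
    proof (rule sum.cong)
      show "scale_bitvec (u v) v = (if u v = 1 then v else 0)" for v
        by (cases "u v") auto
    qed simp
    also have "\<dots> = \<Sum>{v \<in> B. u v = 1}"
      using assms by (simp add: sum.inter_filter)
    finally show "x \<in> (\<lambda>S. \<Sum>S) ` Pow B" by auto
  qed
  show "finite (bitvec.span B)"
    by (rule finite_subset[OF sub]) (use assms in auto)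
  have "card (bitvec.span B) \<le> card ((\<lambda>S. \<Sum>S) ` Pow B)"
    using assms sub by (intro card_mono) auto
  also have "\<dots> \<le> card (Pow B)"
    using assms by (intro card_image_le) auto
  finally show "card (bitvec.span B) \<le> 2 ^ card B"
    using assms by (simp add: card_Pow)
qed

lemma independent_card_le:
  assumes "bitvec.independent B" "B \<subseteq> cube n"
  shows "card B \<le> n"
proof -
  let ?e = "\<lambda>i. (\<lambda>j. if j = i then 1 else 0) :: bitvec"
  have "v \<in> bitvec.span (?e ` {..<n})" if "v \<in> cube n" for v
  proof -
    have "v = (\<Sum>i<n. scale_bitvec (v i) (?e i))"
    proof
      fix j
      have "(\<Sum>i<n. scale_bitvec (v i) (?e i)) j = (\<Sum>i<n. scale_bitvec (v i) (?e i) j)"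
        by (induction n) auto
      also have "\<dots> = (\<Sum>i<n. if i = j then v j else 0)"
        by (intro sum.cong) (auto simp: scale_bitvec_def)
      also have "\<dots> = v j"
        using that by (auto simp: cube_def)
      finally show "v j = (\<Sum>i<n. scale_bitvec (v i) (?e i)) j" by simp
    qed
    also have "\<dots> \<in> bitvec.span (?e ` {..<n})"
      by (intro bitvec.span_sum bitvec.span_scale bitvec.span_base) auto
    finally show ?thesis .
  qed
  then have "card B \<le> card (?e ` {..<n})"
    using assms bitvec.independent_span_bound[of "?e ` {..<n}" B] by blast
  also have "\<dots> \<le> n"
    using card_image_le[of "{..<n}" ?e] by simp
  finally show ?thesis .
qed

section \<open>Probabilities for random subsets\<close>

lemma prob_random_superset:
  assumes "finite G" "D \<subseteq> G"
  shows "measure_pmf.prob (random_subset G) {R. D \<subseteq> R} = 1 / 2 ^ card D"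
proof -
  have "bij_betw (\<lambda>R. R \<union> D) (Pow (G - D)) (Pow G \<inter> {R. D \<subseteq> R})"
    by (rule bij_betw_byWitness[where f' = "\<lambda>R. R - D"]) (use assms in auto)
  then have "card (Pow G \<inter> {R. D \<subseteq> R}) = card (Pow (G - D))"
    by (simp add: bij_betw_same_card)
  also have "\<dots> = 2 ^ (card G - card D)"
    using assms by (simp add: card_Pow card_Diff_subset finite_subset)
  finally have "measure_pmf.prob (random_subset G) {R. D \<subseteq> R} = 2 ^ (card G - card D) / 2 ^ card G"
    using assms by (simp add: random_subset_def measure_pmf_of_set Pow_not_empty card_Pow)
  also have "\<dots> = 1 / 2 ^ card D"
    using assms by (simp add: power_diff card_mono)
  finally show ?thesis .
qed

lemma prob_some_superset_le:
  assumes "finite G" "finite I" "\<And>i. i \<in> I \<Longrightarrow> D i \<subseteq> G"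
  shows "measure_pmf.prob (random_subset G) {R. \<exists>i\<in>I. D i \<subseteq> R} \<le> (\<Sum>i\<in>I. 1 / 2 ^ card (D i))"
proof -
  have "{R. \<exists>i\<in>I. D i \<subseteq> R} = (\<Union>i\<in>I. {R. D i \<subseteq> R})"
    by auto
  then have "measure_pmf.prob (random_subset G) {R. \<exists>i\<in>I. D i \<subseteq> R}
      \<le> (\<Sum>i\<in>I. measure_pmf.prob (random_subset G) {R. D i \<subseteq> R})"
    using assms by (simp add: measure_pmf.finite_measure_subadditive_finite)
  also have "\<dots> = (\<Sum>i\<in>I. 1 / 2 ^ card (D i))"
    using assms by (intro sum.cong prob_random_superset) auto
  finally show ?thesis .
qed

text \<open>
The second moment method.  If \<open>Y\<close> counts the indices \<open>i\<close> with \<open>D i \<subseteq> R\<close> and \<open>\<mu>\<close> is its mean, then \<open>Y = 0\<close>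
forces \<open>(Y - \<mu>)\<^sup>2 = \<mu>\<^sup>2\<close>, and relative to \<open>\<mu>\<^sup>2\<close> the variance is the average of \<open>2 ^ card (D i \<inter> D j) - 1\<close>: the
events \<open>D i \<subseteq> R\<close> and \<open>D j \<subseteq> R\<close> are correlated only through the common part.
\<close>

lemma prob_no_superset_le:
  assumes G: "finite G" and I: "finite I" "I \<noteq> {}"
    and D: "\<And>i. i \<in> I \<Longrightarrow> D i \<subseteq> G" "\<And>i. i \<in> I \<Longrightarrow> card (D i) = s"
  shows "measure_pmf.prob (random_subset G) {R. \<forall>i\<in>I. \<not> D i \<subseteq> R}
    \<le> (\<Sum>i\<in>I. \<Sum>j\<in>I. 2 ^ card (D i \<inter> D j) - 1) / (real (card I))\<^sup>2"
proof -
  let ?M = "measure_pmf (random_subset G)"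
  define ind where "ind i R = (indicator {R. D i \<subseteq> R} R :: real)" for i R
  define Y where "Y R = (\<Sum>i\<in>I. ind i R)" for R
  define \<mu> where "\<mu> = real (card I) / 2 ^ s"
  define T where "T = (\<Sum>i\<in>I. \<Sum>j\<in>I. 2 ^ card (D i \<inter> D j) - 1 :: real)"
  have [simp]: "integrable ?M f" for f :: "_ \<Rightarrow> real"
    by (rule integrable_measure_pmf_finite)
       (use G in \<open>simp add: random_subset_def set_pmf_of_set Pow_not_empty\<close>)
  have Eind: "measure_pmf.expectation (random_subset G) (ind i) = 1 / 2 ^ s" if "i \<in> I" for i
    using prob_random_superset[OF G D(1)[OF that]] D(2)[OF that] by (simp add: ind_def[abs_def])
  have Eind2: "measure_pmf.expectation (random_subset G) (\<lambda>R. ind i R * ind j R)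
      = 2 ^ card (D i \<inter> D j) / (2 ^ s)\<^sup>2" if "i \<in> I" "j \<in> I" for i j
  proof -
    have fin: "finite (D i)" "finite (D j)"
      using D(1) G that finite_subset by blast+
    have "(\<lambda>R. ind i R * ind j R) = indicator {R. D i \<union> D j \<subseteq> R}"
      by (auto simp: ind_def fun_eq_iff indicator_def)
    then have "measure_pmf.expectation (random_subset G) (\<lambda>R. ind i R * ind j R)
        = measure_pmf.prob (random_subset G) {R. D i \<union> D j \<subseteq> R}"
      by simp
    also have "\<dots> = 1 / 2 ^ card (D i \<union> D j)"
      using D(1) that by (intro prob_random_superset[OF G]) auto
    also have "\<dots> = 2 ^ card (D i \<inter> D j) / 2 ^ (card (D i \<union> D j) + card (D i \<inter> D j))"
      by (simp add: power_add)
    also have "card (D i \<union> D j) + card (D i \<inter> D j) = s + s"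
      using card_Un_Int[OF fin] D(2) that by simp
    finally show ?thesis by (simp add: power_add power2_eq_square)
  qed
  have EY: "measure_pmf.expectation (random_subset G) Y = \<mu>"
    using Eind by (simp add: Y_def[abs_def] \<mu>_def)
  have EY2: "measure_pmf.expectation (random_subset G) (\<lambda>R. (Y R)\<^sup>2)
      = (\<Sum>i\<in>I. \<Sum>j\<in>I. 2 ^ card (D i \<inter> D j)) / (2 ^ s)\<^sup>2"
    using Eind2 by (simp add: Y_def power2_eq_square sum_product sum_divide_distrib)
  have pos: "\<mu> > 0" using I by (simp add: \<mu>_def card_gt_0_iff)
  \<comment> \<open>Chebyshev's argument: on the event that no \<open>D i\<close> is contained, \<open>Y\<close> vanishes.\<close>
  have "\<mu>\<^sup>2 * measure_pmf.prob (random_subset G) {R. \<forall>i\<in>I. \<not> D i \<subseteq> R}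
      = measure_pmf.expectation (random_subset G) (\<lambda>R. \<mu>\<^sup>2 * indicator {R. \<forall>i\<in>I. \<not> D i \<subseteq> R} R)"
    by simp
  also have "\<dots> \<le> measure_pmf.expectation (random_subset G) (\<lambda>R. (Y R - \<mu>)\<^sup>2)"
    by (rule integral_mono) (auto simp: Y_def ind_def indicator_def)
  also have "\<dots> = measure_pmf.expectation (random_subset G) (\<lambda>R. (Y R)\<^sup>2 - 2 * \<mu> * Y R + \<mu>\<^sup>2)"
    by (simp add: power2_diff algebra_simps)
  also have "\<dots> = (\<Sum>i\<in>I. \<Sum>j\<in>I. 2 ^ card (D i \<inter> D j)) / (2 ^ s)\<^sup>2 - \<mu>\<^sup>2"
    using EY EY2 by (simp add: power2_eq_square)
  also have "\<dots> = T / (2 ^ s)\<^sup>2"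
    by (simp add: T_def \<mu>_def sum_subtractf power2_eq_square divide_simps)
  also have "\<dots> = \<mu>\<^sup>2 * (T / (real (card I))\<^sup>2)"
    using I by (simp add: \<mu>_def power_divide)
  finally have "measure_pmf.prob (random_subset G) {R. \<forall>i\<in>I. \<not> D i \<subseteq> R} \<le> T / (real (card I))\<^sup>2"
    by (rule mult_left_le_imp_le) (use pos in simp)
  then show ?thesis by (simp add: T_def)
qed

section \<open>Cliques from graphs of random linear maps\<close>

text \<open>
Linear maps from \<open>cube k\<close> to \<open>W\<close>, given by the images of the unit vectors.  Padding with \<open>0\<close> makes the tuples a
group under pointwise addition.
\<close>

definition tuples :: "nat \<Rightarrow> bitvec set \<Rightarrow> (nat \<Rightarrow> bitvec) set" where
  "tuples k W = {w. (\<forall>i<k. w i \<in> W) \<and> (\<forall>i\<ge>k. w i = 0)}"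

lemma tuples_0: "tuples 0 W = {0}"
  by (auto simp: tuples_def fun_eq_iff)

lemma tuples_Suc: "tuples (Suc k) W = (\<lambda>(w, x). w(k := x)) ` (tuples k W \<times> W)"
proof (intro equalityI subsetI)
  fix w assume w: "w \<in> tuples (Suc k) W"
  have "w = (w(k := 0))(k := w k)" by simp
  moreover have "w(k := 0) \<in> tuples k W" "w k \<in> W"
    using w by (auto simp: tuples_def)
  ultimately show "w \<in> (\<lambda>(w, x). w(k := x)) ` (tuples k W \<times> W)"
    by (intro image_eqI[of _ _ "(w(k := 0), w k)"]) auto
qed (auto simp: tuples_def less_Suc_eq)

lemma inj_on_tuples_upd: "inj_on (\<lambda>(w, x). w(k := x)) (tuples k W \<times> W)"
proof (rule inj_onI, clarify)
  fix w x w' x' assume h: "w \<in> tuples k W" "w' \<in> tuples k W" and eq: "w(k := x) = w'(k := x')"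
  have "x = x'" using fun_cong[OF eq, of k] by simp
  moreover have "w i = w' i" for i
    using fun_cong[OF eq, of i] h by (cases "i = k") (auto simp: tuples_def)
  ultimately show "w = w' \<and> x = x'" by auto
qed

lemma card_tuples:
  assumes "finite W"
  shows "finite (tuples k W) \<and> card (tuples k W) = card W ^ k"
proof (induction k)
  case 0
  then show ?case by (simp add: tuples_0)
next
  case (Suc k)
  then show ?case
    using assms by (simp add: tuples_Suc card_image[OF inj_on_tuples_upd] card_cartesian_product)
qed

definition lincomb :: "nat \<Rightarrow> (nat \<Rightarrow> bitvec) \<Rightarrow> bitvec \<Rightarrow> bitvec" where
  "lincomb k w f = (\<Sum>i<k. scale_bitvec (f i) (w i))"

lemma lincomb_add_right: "lincomb k w (f + g) = lincomb k w f + lincomb k w g"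
  by (simp only: lincomb_def plus_fun_apply bitvec.scale_left_distrib sum.distrib)

lemma lincomb_add_left: "lincomb k (w + u) f = lincomb k w f + lincomb k u f"
  by (simp only: lincomb_def plus_fun_apply bitvec.scale_right_distrib sum.distrib)

lemma lincomb_zero [simp]: "lincomb k w 0 = 0"
  by (simp add: lincomb_def)

definition nullspace :: "nat \<Rightarrow> (nat \<Rightarrow> bitvec) \<Rightarrow> bitvec set" where
  "nullspace k u = {f \<in> cube k. lincomb k u f = 0}"

lemma finite_nullspace [simp]: "finite (nullspace k u)"
  by (simp add: nullspace_def)

text \<open>
A new column \<open>x\<close> either lies in the span of the previous columns, and then the fibre over \<open>x\<close> is a coset of the
kernel and the kernel doubles, or the kernel does not change.
\<close>

lemma card_nullspace_Suc:
  "card (nullspace (Suc k) (u(k := x))) =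
    (if x \<in> lincomb k u ` cube k then 2 * card (nullspace k u) else card (nullspace k u))"
proof -
  let ?fib = "{f \<in> cube k. lincomb k u f = x}"
  have l0: "lincomb (Suc k) (u(k := x)) f = lincomb k u f" if "f \<in> cube k" for f x
    using that by (simp add: lincomb_def cube_def)
  have l1: "lincomb (Suc k) (u(k := x)) (f(k := 1)) = lincomb k u f + x" for f x
    by (simp add: lincomb_def)
  have "nullspace (Suc k) (u(k := x)) = nullspace k u \<union> (\<lambda>f. f(k := 1)) ` ?fib"
    unfolding nullspace_def cube_Suc
    by (auto simp: l0 l1 bitvec_add_eq_iff)
  moreover have "card (nullspace k u \<union> (\<lambda>f. f(k := 1)) ` ?fib) = card (nullspace k u) + card ?fib"
  proof -
    have "nullspace k u \<inter> (\<lambda>f. f(k := 1)) ` ?fib = {}"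
      using cube_Suc_disjoint[of k] by (auto simp: nullspace_def)
    moreover have "inj_on (\<lambda>f. f(k := 1)) ?fib"
      by (rule inj_on_subset[OF inj_on_cube_upd]) auto
    ultimately show ?thesis
      by (simp add: card_Un_disjoint card_image)
  qed
  moreover have "card ?fib = (if x \<in> lincomb k u ` cube k then card (nullspace k u) else 0)"
  proof (cases "x \<in> lincomb k u ` cube k")
    case True
    then obtain f0 where f0: "f0 \<in> cube k" "lincomb k u f0 = x" by auto
    have "bij_betw ((+) f0) (nullspace k u) ?fib"
    proof (rule bij_betw_byWitness[where f' = "(+) f0"])
      show "\<forall>a\<in>nullspace k u. f0 + (f0 + a) = a" "\<forall>a'\<in>?fib. f0 + (f0 + a') = a'"
        by (simp_all add: add.assoc[symmetric])
    qed (use f0 in \<open>auto simp: nullspace_def lincomb_add_right\<close>)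
    from bij_betw_same_card[OF this] show ?thesis using True by simp
  next
    case False
    then have "?fib = {}" by auto
    then show ?thesis using False by simp
  qed
  ultimately show ?thesis by simp
qed

lemma card_nullspace_eq_power: "\<exists>d\<le>k. card (nullspace k u) = 2 ^ d"
proof (induction k arbitrary: u)
  case 0
  have "nullspace 0 u = {0}" by (auto simp: nullspace_def cube_0)
  then show ?case by simp
next
  case (Suc k)
  obtain d where "d \<le> k" "card (nullspace k u) = 2 ^ d" using Suc by blast
  then show ?case
    using card_nullspace_Suc[of k u "u k"]
    by (cases "u k \<in> lincomb k u ` cube k")
       (auto intro: exI[of _ "Suc d"] exI[of _ d])
qed

text \<open>
After \<open>k\<close> columns, the kernel doubles with a further one only if this is one of the at most \<open>2 ^ k\<close>
combinations of the previous columns.  Each doubling thus costs a factor \<open>2 ^ k / card W\<close>, and the factor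
\<open>2 ^ d\<close> that the bound gains when \<open>k\<close> grows by one absorbs the choice between the two cases.
\<close>

lemma card_tuples_with_nullspace:
  assumes W: "finite W"
  shows "card {u \<in> tuples k W. card (nullspace k u) = 2 ^ d} * card W ^ d \<le> card W ^ k * 2 ^ ((k + 1) * d)"
proof (induction k arbitrary: d)
  case 0
  have "nullspace 0 u = {0}" for u by (auto simp: nullspace_def cube_0)
  then show ?case by (cases d) (auto simp: tuples_0)
next
  case (Suc k)
  let ?h = "\<lambda>k d. {u \<in> tuples k W. card (nullspace k u) = 2 ^ d}"
  have fin: "finite (tuples k W)" for k using card_tuples[OF W] by blast
  show ?case
  proof (cases d)
    case 0
    have "card (?h (Suc k) d) \<le> card (tuples (Suc k) W)"
      by (rule card_mono) (use fin in auto)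
    then show ?thesis using 0 card_tuples[OF W, of "Suc k"] by simp
  next
    case (Suc e)
    let ?A = "?h k d \<times> W"
    let ?B = "SIGMA u:?h k e. lincomb k u ` cube k"
    have "?h (Suc k) d \<subseteq> (\<lambda>(w, x). w(k := x)) ` (?A \<union> ?B)"
    proof
      fix u assume "u \<in> ?h (Suc k) d"
      then obtain w x where u: "u = w(k := x)" "w \<in> tuples k W" "x \<in> W"
        and c: "card (nullspace (Suc k) (w(k := x))) = 2 ^ d"
        by (auto simp: tuples_Suc)
      have "(w, x) \<in> ?A \<union> ?B"
        using u c Suc unfolding card_nullspace_Suc by (auto split: if_splits)
      then show "u \<in> (\<lambda>(w, x). w(k := x)) ` (?A \<union> ?B)"
        using u by (intro image_eqI[of _ _ "(w, x)"]) auto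
    qed
    moreover have finAB: "finite (?A \<union> ?B)"
      using fin[of k] W by auto
    ultimately have "card (?h (Suc k) d) \<le> card ((\<lambda>(w, x). w(k := x)) ` (?A \<union> ?B))"
      by (intro card_mono finite_imageI)
    also have "\<dots> \<le> card (?A \<union> ?B)"
      by (rule card_image_le[OF finAB])
    also have "\<dots> \<le> card ?A + card ?B"
      by (rule card_Un_le)
    also have "card ?B = (\<Sum>u\<in>?h k e. card (lincomb k u ` cube k))"
      using fin[of k] by (subst card_SigmaI) auto
    also have "\<dots> \<le> (\<Sum>u\<in>?h k e. 2 ^ k)"
      by (intro sum_mono) (use card_image_le[of "cube k"] card_cube in auto)
    also have "card ?A = card (?h k d) * card W"
      by (rule card_cartesian_product)
    finally have "card (?h (Suc k) d) \<le> card (?h k d) * card W + card (?h k e) * 2 ^ k"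
      by simp
    then have "card (?h (Suc k) d) * card W ^ d
        \<le> (card (?h k d) * card W + card (?h k e) * 2 ^ k) * card W ^ d"
      by (rule mult_right_mono) simp
    also have "\<dots> = card W * (card (?h k d) * card W ^ d)
        + card W * 2 ^ k * (card (?h k e) * card W ^ e)"
      by (simp add: Suc algebra_simps)
    also have "\<dots> \<le> card W * (card W ^ k * 2 ^ ((k + 1) * d))
        + card W * 2 ^ k * (card W ^ k * 2 ^ ((k + 1) * e))"
      by (intro add_mono mult_left_mono Suc.IH) auto
    also have "\<dots> = card W ^ Suc k * (2 ^ ((k + 1) * d) + 2 ^ (k + (k + 1) * e))"
      by (simp add: algebra_simps power_add)
    also have "(2::nat) ^ ((k + 1) * d) + 2 ^ (k + (k + 1) * e) \<le> 2 ^ ((k + 1) * d) + 2 ^ ((k + 1) * d)"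
      by (intro add_left_mono power_increasing) (auto simp: Suc)
    also have "\<dots> = 2 ^ Suc ((k + 1) * d)" by simp
    also have "(2::nat) ^ Suc ((k + 1) * d) \<le> 2 ^ ((Suc k + 1) * d)"
      by (rule power_increasing) (auto simp: Suc)
    finally show ?thesis by simp
  qed
qed

definition high_part :: "nat \<Rightarrow> nat \<Rightarrow> bitvec set" where
  "high_part k n = {v \<in> cube n. \<forall>i<k. v i = 0}"

lemma card_high_part:
  assumes "k \<le> n"
  shows "finite (high_part k n) \<and> card (high_part k n) = 2 ^ (n - k)"
proof -
  have "bij_betw (\<lambda>v i. if i < k then 0 else v (i - k)) (cube (n - k)) (high_part k n)"
    by (rule bij_betw_byWitness[where f' = "\<lambda>v i. v (i + k)"])
       (use assms in \<open>auto simp: high_part_def cube_def fun_eq_iff\<close>)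
  then have "card (cube (n - k)) = card (high_part k n)"
    by (rule bij_betw_same_card)
  then show ?thesis using card_cube[of "n - k"] by (simp add: high_part_def)
qed

lemma lincomb_high_part:
  assumes "w \<in> tuples k (high_part k n)"
  shows "lincomb k w f \<in> high_part k n"
proof -
  have "bitvec.subspace (high_part k n)"
    by (auto simp: bitvec.subspace_def scale_bitvec_def cube_def high_part_def)
  then show ?thesis
    unfolding lincomb_def using assms
    by (intro bitvec.subspace_sum bitvec.subspace_scale) (auto simp: tuples_def)
qed

lemma low_high_unique:
  assumes "f \<in> cube k" "g \<in> cube k" "x \<in> high_part k n" "y \<in> high_part k n" "f + x = g + y"
  shows "f = g" "x = y"
proof -
  have "f i + x i = g i + y i" for i
    using fun_cong[OF assms(5), of i] by (simp only: plus_fun_apply)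
  moreover have "x i = 0 \<and> y i = 0" if "i < k" for i
    using assms(3,4) that by (simp add: high_part_def)
  moreover have "f i = 0 \<and> g i = 0" if "\<not> i < k" for i
    using assms(1,2) that by (simp add: cube_def)
  ultimately have "f i = g i" for i
    by (metis add.right_neutral)
  then show "f = g" by auto
  then show "x = y" using assms by simp
qed

text \<open>
The graph of the linear map given by \<open>w\<close>: if the map takes values in \<open>high_part k n\<close>, then the sum of \<open>f\<close> and
its image determines both and can stand for the pair.
\<close>

definition graph_space :: "nat \<Rightarrow> (nat \<Rightarrow> bitvec) \<Rightarrow> bitvec set" where
  "graph_space k w = (\<lambda>f. f + lincomb k w f) ` cube k"

lemma graph_space_sumset: "graph_space k w + graph_space k w \<subseteq> graph_space k w"
proof
  fix z assume "z \<in> graph_space k w + graph_space k w"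
  then obtain f g where fg: "f \<in> cube k" "g \<in> cube k" "z = (f + lincomb k w f) + (g + lincomb k w g)"
    by (auto simp: graph_space_def set_plus_def)
  then have "z = (f + g) + lincomb k w (f + g)"
    by (simp add: lincomb_add_right add_ac)
  then show "z \<in> graph_space k w"
    unfolding graph_space_def using cube_add[OF fg(1,2)] by (intro image_eqI[of _ _ "f + g"])
qed

context
  fixes k n :: nat and W :: "bitvec set"
  assumes kn: "k \<le> n"
  defines "W \<equiv> high_part k n"
begin

lemma graph_map_inj:
  assumes "w \<in> tuples k W" "w' \<in> tuples k W" "f \<in> cube k" "g \<in> cube k"
    "f + lincomb k w f = g + lincomb k w' g"
  shows "f = g"
  using low_high_unique(1)[OF assms(3,4) lincomb_high_part lincomb_high_part assms(5)] assms(1,2)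
  by (simp add: W_def)

lemma card_graph_space:
  assumes w: "w \<in> tuples k W"
  shows "card (graph_space k w) = 2 ^ k"
proof -
  have "inj_on (\<lambda>f. f + lincomb k w f) (cube k)"
    by (intro inj_onI) (rule graph_map_inj[OF w w])
  then show ?thesis by (simp add: graph_space_def card_image card_cube)
qed

lemma graph_space_subset:
  assumes "w \<in> tuples k W"
  shows "graph_space k w \<subseteq> cube n"
proof -
  have "lincomb k w f \<in> cube n" for f
    using lincomb_high_part assms by (auto simp: W_def high_part_def)
  moreover have "cube k \<subseteq> cube n" using kn by (auto simp: cube_def)
  ultimately show ?thesis by (auto simp: graph_space_def)
qed

text \<open>
Two graphs agree over \<open>f\<close> exactly when \<open>f\<close> is in the kernel of the difference of the two maps, which is their
sum in characteristic two.
\<close>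

lemma card_graph_space_Int:
  assumes w: "w \<in> tuples k W" "w' \<in> tuples k W"
  shows "card ((graph_space k w - {0}) \<inter> (graph_space k w' - {0})) = card (nullspace k (w + w')) - 1"
proof -
  let ?g = "\<lambda>f. f + lincomb k w f"
  have inj: "inj_on ?g (cube k)"
    by (intro inj_onI) (rule graph_map_inj[OF w(1) w(1)])
  have "graph_space k w \<inter> graph_space k w' = ?g ` nullspace k (w + w')"
  proof (intro equalityI subsetI)
    fix z assume "z \<in> graph_space k w \<inter> graph_space k w'"
    then obtain f g where fg: "f \<in> cube k" "g \<in> cube k" "z = ?g f" "?g f = g + lincomb k w' g"
      by (auto simp: graph_space_def)
    then have "f = g" using graph_map_inj[OF w] by blast
    then have "lincomb k (w + w') f = 0"
      using fg by (simp add: lincomb_add_left)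
    then have "f \<in> nullspace k (w + w')"
      using fg(1) by (simp add: nullspace_def)
    then show "z \<in> ?g ` nullspace k (w + w')"
      unfolding fg(3) by (rule imageI)
  next
    fix z assume "z \<in> ?g ` nullspace k (w + w')"
    then obtain f where f: "f \<in> cube k" "lincomb k w f + lincomb k w' f = 0" "z = ?g f"
      by (auto simp: nullspace_def lincomb_add_left)
    then have "lincomb k w f = lincomb k w' f"
      by (simp add: bitvec_add_eq_iff)
    then have "z = f + lincomb k w' f" using f(3) by simp
    then show "z \<in> graph_space k w \<inter> graph_space k w'"
      unfolding graph_space_def using f(1,3) by blast
  qed
  then have "(graph_space k w - {0}) \<inter> (graph_space k w' - {0}) = ?g ` nullspace k (w + w') - {0}"
    by blast
  then have "card ((graph_space k w - {0}) \<inter> (graph_space k w' - {0}))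
      = card (?g ` nullspace k (w + w') - {0})"
    by (rule arg_cong)
  also have "\<dots> = card (?g ` nullspace k (w + w')) - 1"
    by (subst card_Diff_singleton) (auto simp: nullspace_def intro!: image_eqI[of _ _ 0])
  also have "card (?g ` nullspace k (w + w')) = card (nullspace k (w + w'))"
    by (rule card_image[OF inj_on_subset[OF inj]]) (auto simp: nullspace_def)
  finally show ?thesis .
qed

text \<open>
Injective maps contribute nothing, and maps with a kernel of size \<open>2 ^ d\<close> contribute at most
\<open>2 powr (2 ^ d + (k + 1) * d - (n - k) * d)\<close> on average.
Since \<open>2 ^ d / d\<close> increases with \<open>d\<close>, the condition \<open>4 * 2 ^ k \<le> n * k\<close> for the largest kernel gives
\<open>2 ^ d \<le> n * d / 4\<close> for all of them.  As \<open>(2 * k + 1) * d\<close> is at most \<open>n * d / 4\<close> too, the term \<open>- n * d\<close>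
dominates.
\<close>

lemma sum_nullspace_weights:
  assumes k: "4 * 2 ^ k \<le> n * k" "8 * k + 4 \<le> n"
  shows "(\<Sum>u\<in>tuples k W. 2 ^ (card (nullspace k u) - 1) - 1) \<le> real (card (tuples k W)) * (k / 2 ^ (n div 4))"
proof -
  let ?h = "\<lambda>d. {u \<in> tuples k W. card (nullspace k u) = 2 ^ d}"
  have W: "finite W" "card W = 2 ^ (n - k)"
    using card_high_part[OF kn] by (simp_all add: W_def)
  have fin: "finite (tuples k W)" and cardT: "card (tuples k W) = card W ^ k"
    using card_tuples[OF W(1)] by auto
  have conv: "k * 2 ^ d \<le> d * 2 ^ k" if "1 \<le> d" "d \<le> k" for d
    using that(2)
  proof (induction k rule: dec_induct)
    case (step m)
    have "Suc m * 2 ^ d = m * 2 ^ d + 2 ^ d" by simp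
    also have "\<dots> \<le> d * 2 ^ m + d * 2 ^ m"
      using step that(1) by (intro add_mono) (auto intro: le_trans[OF power_increasing[of d m 2]])
    finally show ?case by simp
  qed simp
  have bound: "real (card (?h d)) * 2 ^ (2 ^ d) \<le> card (tuples k W) * (1 / 2 ^ (n div 4))"
    if d: "1 \<le> d" "d \<le> k" for d
  proof -
    have kpos: "k > 0" using d by simp
    have "k * (4 * 2 ^ d) \<le> d * (4 * 2 ^ k)" using conv[OF d] by simp
    also have "\<dots> \<le> k * (d * n)" using k(1) by (simp add: algebra_simps)
    finally have e1: "4 * 2 ^ d \<le> d * n" using kpos by simp
    have e2: "d * (8 * k + 4) \<le> d * n" using k(2) by simp
    have e3: "4 * (n div 4) \<le> d * n"
      using d by (rule_tac order_trans[of _ n]) auto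
    have e4: "(n - k) * d + k * d = d * n"
      using kn by (simp add: distrib_right[symmetric])
    have e5: "(k + 1) * d = k * d + d" "d * (8 * k + 4) = 8 * (k * d) + 4 * d"
      by (simp_all add: algebra_simps)
    have expo: "(k + 1) * d + 2 ^ d + n div 4 \<le> (n - k) * d"
      using e1 e2 e3 e4 unfolding e5 by linarith
    have "card (?h d) * card W ^ d * 2 ^ (2 ^ d + n div 4)
        \<le> card W ^ k * 2 ^ ((k + 1) * d) * 2 ^ (2 ^ d + n div 4)"
      using card_tuples_with_nullspace[OF W(1), of k d] by (rule mult_right_mono) simp
    also have "\<dots> = card W ^ k * 2 ^ ((k + 1) * d + 2 ^ d + n div 4)"
      by (simp add: power_add)
    also have "\<dots> \<le> card W ^ k * 2 ^ ((n - k) * d)"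
      using expo by (intro mult_left_mono power_increasing) auto
    also have "2 ^ ((n - k) * d) = card W ^ d" by (simp add: W power_mult)
    finally have "card W ^ d * (card (?h d) * 2 ^ 2 ^ d * 2 ^ (n div 4)) \<le> card W ^ d * card W ^ k"
      by (simp add: power_add algebra_simps)
    then have "card (?h d) * 2 ^ 2 ^ d * 2 ^ (n div 4) \<le> card (tuples k W)"
      unfolding cardT by (rule mult_left_le_imp_le) (simp add: W)
    then have "real (card (?h d) * 2 ^ 2 ^ d * 2 ^ (n div 4)) \<le> card (tuples k W)"
      by (rule of_nat_mono)
    then show ?thesis by (simp add: field_simps)
  qed
  have "(\<Sum>u\<in>tuples k W. 2 ^ (card (nullspace k u) - 1) - 1)
      \<le> (\<Sum>u\<in>tuples k W. \<Sum>d\<in>{1..k}. if card (nullspace k u) = 2 ^ d then 2 ^ 2 ^ d else (0::real))"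
  proof (rule sum_mono)
    fix u
    obtain d where d: "d \<le> k" "card (nullspace k u) = 2 ^ d" using card_nullspace_eq_power by blast
    have "2 ^ (card (nullspace k u) - 1) - 1 \<le> (if d = 0 then 0 else 2 ^ 2 ^ d :: real)"
    proof (cases "d = 0")
      case False
      have "(2::real) ^ (2 ^ d - 1) \<le> 2 ^ 2 ^ d" by (intro power_increasing) auto
      then have "(2::real) ^ (2 ^ d - 1) - 1 \<le> 2 ^ 2 ^ d" by linarith
      then show ?thesis using d(2) False by simp
    qed (use d in simp)
    also have "\<dots> \<le> (\<Sum>e\<in>{1..k}. if d = e then 2 ^ 2 ^ e else (0::real))"
    proof (cases "d = 0")
      case True
      then show ?thesis by (simp add: sum_nonneg)
    next
      case False
      then show ?thesis using d(1) by (simp add: sum.delta')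
    qed
    also have "\<dots> = (\<Sum>e\<in>{1..k}. if card (nullspace k u) = 2 ^ e then 2 ^ 2 ^ e else 0)"
      by (simp add: d)
    finally show "2 ^ (card (nullspace k u) - 1) - 1
        \<le> (\<Sum>e\<in>{1..k}. if card (nullspace k u) = 2 ^ e then 2 ^ 2 ^ e else (0::real))" .
  qed
  also have "\<dots> = (\<Sum>d\<in>{1..k}. \<Sum>u\<in>tuples k W. if card (nullspace k u) = 2 ^ d then 2 ^ 2 ^ d else 0)"
    by (rule sum.swap)
  also have "\<dots> = (\<Sum>d\<in>{1..k}. real (card (?h d)) * 2 ^ 2 ^ d)"
    using fin by (simp add: sum.inter_filter[symmetric])
  also have "\<dots> \<le> (\<Sum>d\<in>{1..k}. card (tuples k W) * (1 / 2 ^ (n div 4)))"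
    using bound by (intro sum_mono) auto
  also have "\<dots> = real (card (tuples k W)) * (k / 2 ^ (n div 4))"
    by simp
  finally show ?thesis .
qed

lemma prob_no_graph_space:
  assumes k: "4 * 2 ^ k \<le> n * k" "8 * k + 4 \<le> n"
  shows "measure_pmf.prob (random_subset (cube n)) {R. \<forall>w\<in>tuples k W. \<not> graph_space k w - {0} \<subseteq> R}
    \<le> k / 2 ^ (n div 4)"
proof -
  let ?I = "tuples k W"
  have "finite W" using card_high_part[OF kn] by (simp add: W_def)
  then have fin: "finite ?I" using card_tuples by blast
  have "0 \<in> W" by (simp add: W_def high_part_def)
  then have "0 \<in> ?I" by (simp add: tuples_def)
  then have ne: "?I \<noteq> {}" by blast
  then have pos: "real (card ?I) > 0" using fin by (simp add: card_gt_0_iff)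
  \<comment> \<open>Pairs of maps are parametrised by one map and the difference \<open>u\<close>, on which the intersection depends.\<close>
  have closed: "w + u \<in> ?I" if "w \<in> ?I" "u \<in> ?I" for w u
    using that by (auto simp: tuples_def W_def high_part_def)
  have zero_mem: "0 \<in> graph_space k w" for w
    by (auto simp: graph_space_def intro!: image_eqI[of _ _ 0])
  have "measure_pmf.prob (random_subset (cube n)) {R. \<forall>w\<in>?I. \<not> graph_space k w - {0} \<subseteq> R}
    \<le> (\<Sum>w\<in>?I. \<Sum>w'\<in>?I. 2 ^ card ((graph_space k w - {0}) \<inter> (graph_space k w' - {0})) - 1)
        / (real (card ?I))\<^sup>2"
    by (rule prob_no_superset_le[where s = "2 ^ k - 1"])
       (use fin ne graph_space_subset card_graph_space zero_mem in \<open>auto simp: card_Diff_singleton\<close>)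
  also have "(\<Sum>w\<in>?I. \<Sum>w'\<in>?I. 2 ^ card ((graph_space k w - {0}) \<inter> (graph_space k w' - {0})) - 1)
      = (\<Sum>w\<in>?I. \<Sum>u\<in>?I. 2 ^ (card (nullspace k u) - 1) - (1::real))"
  proof (rule sum.cong)
    fix w assume w: "w \<in> ?I"
    have ww: "w + (w + u) = u" for u
      by (simp add: fun_eq_iff)
    show "(\<Sum>w'\<in>?I. 2 ^ card ((graph_space k w - {0}) \<inter> (graph_space k w' - {0})) - 1)
        = (\<Sum>u\<in>?I. 2 ^ (card (nullspace k u) - 1) - (1::real))"
      by (rule sum.reindex_bij_witness[where i = "\<lambda>u. w + u" and j = "\<lambda>w'. w + w'"])
         (use w closed ww card_graph_space_Int in auto)
  qed simp
  also have "\<dots> = real (card ?I) * (\<Sum>u\<in>?I. 2 ^ (card (nullspace k u) - 1) - 1)"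
    by simp
  also have "\<dots> / (real (card ?I))\<^sup>2 = (\<Sum>u\<in>?I. 2 ^ (card (nullspace k u) - 1) - 1) / real (card ?I)"
    using pos by (simp add: power2_eq_square)
  also have "\<dots> \<le> k / 2 ^ (n div 4)"
    using sum_nullspace_weights[OF k] pos by (simp add: divide_le_eq mult.commute)
  finally show ?thesis .
qed

lemma prob_no_large_clique_le:
  assumes k: "4 * 2 ^ k \<le> n * k" "8 * k + 4 \<le> n"
  shows "measure_pmf.prob (random_subset (cube n))
      {R. \<not> (\<exists>K\<subseteq>cube n. card K = 2 ^ k \<and> K + K - {0} \<subseteq> R)} \<le> k / 2 ^ (n div 4)"
proof -
  have "{R. \<not> (\<exists>K\<subseteq>cube n. card K = 2 ^ k \<and> K + K - {0} \<subseteq> R)}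
      \<subseteq> {R. \<forall>w\<in>tuples k W. \<not> graph_space k w - {0} \<subseteq> R}"
  proof clarify
    fix R w
    assume none: "\<not> (\<exists>K\<subseteq>cube n. card K = 2 ^ k \<and> K + K - {0} \<subseteq> R)"
      and w: "w \<in> tuples k W" and sub: "graph_space k w - {0} \<subseteq> R"
    have "graph_space k w + graph_space k w - {0} \<subseteq> R"
      using sub graph_space_sumset[of k w] by blast
    then show False
      using none graph_space_subset[OF w] card_graph_space[OF w] by blast
  qed
  then show ?thesis
    by (intro order_trans[OF measure_pmf.finite_measure_mono prob_no_graph_space[OF k]]) auto
qed

end

section \<open>Sumsets and popular differences\<close>

lemma finite_sumset [simp]: "finite A \<Longrightarrow> finite B \<Longrightarrow> finite (A + B)"
  for A B :: "'a::plus set"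
  by (simp add: finite_set_plus)

text \<open>
The threshold one half balances two needs: an element that is not popular enlarges \<open>S + S\<close> by more than half
the size of \<open>S\<close>, and the number of popular elements stays linear in the size of \<open>S + S\<close>.
\<close>

definition popular :: "'a::ab_group_add set \<Rightarrow> 'a set" where
  "popular S = {a. card S \<le> 2 * card {s \<in> S. a + s \<in> S + S}}"

text \<open>
Double counting: a pair \<open>(a, s)\<close> with \<open>a + s \<in> S + S\<close> is determined by \<open>s\<close> and the sum, and each popular element
occurs in at least \<open>card S / 2\<close> such pairs.
\<close>

lemma popular_bound:
  fixes S :: "'a::ab_group_add set"
  assumes "finite S" "S \<noteq> {}"
  shows "finite (popular S)" "card (popular S) \<le> 2 * card (S + S)"
proof -
  let ?R = "\<lambda>a. {s \<in> S. a + s \<in> S + S}"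
  have pos: "card S > 0"
    using assms by (simp add: card_gt_0_iff)
  have ne: "?R a \<noteq> {}" if "a \<in> popular S" for a
  proof
    assume "?R a = {}"
    then have "card S \<le> 2 * 0"
      using that unfolding popular_def by (metis (mono_tags, lifting) card.empty mem_Collect_eq)
    then show False using pos by simp
  qed
  have "popular S \<subseteq> (\<lambda>(x, s). x - s) ` ((S + S) \<times> S)"
  proof
    fix a assume "a \<in> popular S"
    from ne[OF this] obtain s where "s \<in> S" "a + s \<in> S + S" by blast
    then show "a \<in> (\<lambda>(x, s). x - s) ` ((S + S) \<times> S)"
      by (intro image_eqI[of _ _ "(a + s, s)"]) auto
  qed
  then show fin: "finite (popular S)"
    by (rule finite_subset) (use assms in auto)
  have "card (popular S) * card S = (\<Sum>a\<in>popular S. card S)"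
    by simp
  also have "\<dots> \<le> (\<Sum>a\<in>popular S. 2 * card (?R a))"
    by (intro sum_mono) (auto simp: popular_def)
  also have "\<dots> = 2 * card (SIGMA a:popular S. ?R a)"
    using fin assms by (simp add: sum_distrib_left)
  also have "card (SIGMA a:popular S. ?R a) \<le> card (S \<times> (S + S))"
    by (rule card_inj_on_le[where f = "\<lambda>(a, s). (s, a + s)"])
       (use assms in \<open>auto simp: inj_on_def\<close>)
  finally have "card (popular S) * card S \<le> 2 * card (S + S) * card S"
    by (simp add: card_cartesian_product algebra_simps)
  then show "card (popular S) \<le> 2 * card (S + S)"
    using pos by simp
qed

text \<open>
Among the sets between \<open>B\<close> and \<open>A\<close> that satisfy the size condition, a largest one works.  If some \<open>a \<in> A\<close> were
not popular for it, then adding \<open>a\<close> would create more than \<open>card S / 2\<close> new sums, which pays for the increase of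
the square \<open>(card S - card B)\<^sup>2\<close> by \<open>2 * (card S - card B) + 1\<close>.
\<close>

lemma greedy_skeleton:
  fixes A B :: "'a::ab_group_add set"
  assumes "finite A" "B \<subseteq> A" "B \<noteq> {}"
  obtains S where "B \<subseteq> S" "S \<subseteq> A" "(card S - card B)\<^sup>2 \<le> 4 * card (S + S)" "A \<subseteq> popular S"
proof -
  let ?P = "\<lambda>S. B \<subseteq> S \<and> S \<subseteq> A \<and> (card S - card B)\<^sup>2 \<le> 4 * card (S + S)"
  have P0: "?P B" using assms by auto
  have fin: "finite {S. ?P S}"
    using \<open>finite A\<close> by (rule_tac finite_subset[of _ "Pow A"]) blast+
  have "Max (card ` {S. ?P S}) \<in> card ` {S. ?P S}"
    using fin P0 by (intro Max_in finite_imageI) blast+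
  then obtain S where S: "?P S" and S_max: "card S = Max (card ` {S. ?P S})"
    by auto
  have max: "card T \<le> card S" if "?P T" for T
    unfolding S_max using that fin by (intro Max_ge finite_imageI imageI) blast+
  have fS: "finite S" using S assms finite_subset by blast
  have "a \<in> popular S" if a: "a \<in> A" for a
  proof (rule ccontr)
    assume np: "a \<notin> popular S"
    let ?R = "{s \<in> S. a + s \<in> S + S}"
    have few: "2 * card ?R < card S"
      using np by (simp add: popular_def)
    have aS: "a \<notin> S"
    proof
      assume "a \<in> S"
      then have "?R = S" by auto
      then show False using few by simp
    qed
    let ?T = "insert a S"
    let ?new = "(+) a ` (S - ?R)"
    have "card (S + S) + card ?new = card ((S + S) \<union> ?new)"
      using fS by (intro card_Un_disjoint[symmetric]) auto
    also have "\<dots> \<le> card (?T + ?T)"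
      using fS by (intro card_mono) (auto simp: set_plus_def)
    finally have "card (S + S) + card (S - ?R) \<le> card (?T + ?T)"
      by (simp add: card_image)
    moreover have "card (S - ?R) = card S - card ?R"
      using fS by (intro card_Diff_subset) auto
    moreover have "card ?T - card B = Suc (card S - card B)"
      using aS fS S card_mono[of S B] by (simp add: Suc_diff_le)
    moreover have "(Suc t)\<^sup>2 = t\<^sup>2 + 2 * t + 1" for t :: nat
      by (simp add: power2_eq_square)
    moreover have "card S - card B \<le> card S" by simp
    ultimately have "(card ?T - card B)\<^sup>2 \<le> (card S - card B)\<^sup>2 + 2 * card S + 1"
      "2 * card S + 1 \<le> 4 * (card (?T + ?T) - card (S + S))" "card (S + S) \<le> card (?T + ?T)"
      using few by simp_all
    then have "(card ?T - card B)\<^sup>2 \<le> 4 * card (?T + ?T)"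
      using S by linarith
    then have "?P ?T" using S a by blast
    from max[OF this] show False using aS fS by simp
  qed
  with S that show ?thesis by blast
qed

lemma card_sumset_ge: "finite A \<Longrightarrow> card A \<le> card (A + A)" for A :: "'a::ab_group_add set"
proof (cases "A = {}")
  case False
  assume "finite A"
  from False obtain a where "a \<in> A" by blast
  then show ?thesis
    using \<open>finite A\<close> by (intro card_inj_on_le[where f = "(+) a"]) (auto simp: inj_on_def)
qed simp

lemma card_sumset_le: "finite A \<Longrightarrow> finite B \<Longrightarrow> card (A + B) \<le> card A * card B"
  for A :: "'a::ab_group_add set"
proof -
  assume f: "finite A" "finite B"
  have "A + B = (\<lambda>(a, b). a + b) ` (A \<times> B)"
    by (auto simp: set_plus_def)
  then show ?thesis
    using card_image_le[of "A \<times> B" "\<lambda>(a, b). a + b"] f by (simp add: card_cartesian_product)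
qed

section \<open>Edge isoperimetry in the cube\<close>

text \<open>
The inequality that lets the edge bound pass through a decomposition into two halves.  It follows from
\<open>2 powr u \<le> 1 + u\<close> for \<open>u\<close> between \<open>0\<close> and \<open>1\<close>, a case of convexity, applied to \<open>u = y / x\<close>.
\<close>

lemma entropy_ineq_aux:
  fixes x y :: real
  assumes "0 < y" "y \<le> x"
  shows "x * log 2 x + y * log 2 y + 2 * y \<le> (x + y) * log 2 (x + y)"
proof -
  define u where "u = y / x"
  have u: "0 < u" "u \<le> 1" using assms by (auto simp: u_def)
  have "2 powr u \<le> 1 + u"
  proof -
    have "convex_on {0..1::real} (\<lambda>t. 2 powr t)"
      using convex_on_subset[OF convex_on_exp[of "ln 2"], of "{0..1}"]
      by (simp add: powr_def mult.commute)
    from convex_onD[OF this, of u 0 1] u show ?thesis by simp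
  qed
  then have "log 2 (2 powr u) \<le> log 2 (1 + u)"
    using u by (intro log_mono) auto
  then have "u \<le> log 2 (1 + u)" by simp
  then have "x * u \<le> x * log 2 (1 + u)"
    using assms by (intro mult_left_mono) auto
  moreover have "x * u = y" using assms by (simp add: u_def)
  moreover have "log 2 (1 + u) = log 2 (x + y) - log 2 x"
  proof -
    have "1 + u = (x + y) / x" using assms by (simp add: u_def add_divide_distrib)
    then show ?thesis using assms by (simp add: log_divide_pos)
  qed
  ultimately have 1: "y \<le> x * log 2 (x + y) - x * log 2 x"
    by (simp only: right_diff_distrib)
  have "log 2 (2 * y) \<le> log 2 (x + y)"
    using assms by (intro log_mono) auto
  also have "log 2 (2 * y) = 1 + log 2 y"
    using assms by (simp add: log_mult_pos)
  finally have "y * (1 + log 2 y) \<le> y * log 2 (x + y)"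
    using assms by (intro mult_left_mono) auto
  with 1 show ?thesis by (simp add: distrib_left distrib_right)
qed

lemma entropy_ineq:
  fixes x y :: nat
  shows "x * log 2 x + y * log 2 y + 2 * min x y \<le> (x + y) * log 2 (x + y)"
proof (cases "x = 0 \<or> y = 0")
  case True
  then show ?thesis by auto
next
  case False
  show ?thesis
  proof (cases "y \<le> x")
    case True
    then show ?thesis using entropy_ineq_aux[of y x] False by (simp add: min.absorb2)
  next
    case *: False
    then show ?thesis using entropy_ineq_aux[of x y] False by (simp add: min.absorb1 add.commute)
  qed
qed

text \<open>
In coordinates with respect to \<open>B\<close>, this counts the ordered edges of the cube inside \<open>F\<close>.  The proof splits
\<open>F\<close> along the direction \<open>b\<close> into the part \<open>F0\<close> in the span of the other basis vectors and the rest \<open>F1\<close>, which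
is translated by \<open>b\<close> into the same span.  At most \<open>min (card F0) (card F1)\<close> edges join the two parts, each
counted in both orders, and \<open>entropy_ineq\<close> combines the bounds for the parts.
\<close>

lemma edge_isoperimetry:
  assumes "finite B" "bitvec.independent B" "finite F" "F \<subseteq> bitvec.span B"
  shows "card {(f, b). f \<in> F \<and> b \<in> B \<and> f + b \<in> F} \<le> card F * log 2 (card F)"
  using assms
proof (induction B arbitrary: F rule: finite_induct)
  case empty
  have "card F * log 2 (card F) \<ge> 0"
    by (cases "card F") auto
  then show ?case by simp
next
  case (insert b B)
  let ?E = "\<lambda>F B. {(f, c). f \<in> F \<and> c \<in> B \<and> f + c \<in> F}"
  have ind: "bitvec.independent B" and b: "b \<notin> bitvec.span B"
    using insert by (auto simp: bitvec.independent_insert)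
  define F0 where "F0 = F \<inter> bitvec.span B"
  define F1 where "F1 = F - bitvec.span B"
  define G where "G = (+) b ` F1"
  have F: "F = F0 \<union> F1" "F0 \<inter> F1 = {}" and fin: "finite F0" "finite F1" "finite G"
    using insert.prems by (auto simp: F0_def F1_def G_def)
  have cardG: "card G = card F1"
    by (simp add: G_def card_image)
  have toggle: "f + b \<notin> bitvec.span B" if "f \<in> bitvec.span B" for f
  proof
    assume "f + b \<in> bitvec.span B"
    from bitvec.span_diff[OF this that] b show False by (simp add: add.commute)
  qed
  have G: "G \<subseteq> bitvec.span B"
  proof
    fix g assume "g \<in> G"
    then obtain f where f: "g = b + f" "f \<in> F1" by (auto simp: G_def)
    then have "f \<in> bitvec.span (insert b B)" "f \<notin> bitvec.span B"
      using insert.prems by (auto simp: F1_def)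
    then obtain k where k: "f - scale_bitvec k b \<in> bitvec.span B"
      using bitvec.span_breakdown_eq by blast
    show "g \<in> bitvec.span B"
    proof (cases k)
      case zero
      then show ?thesis using k \<open>f \<notin> bitvec.span B\<close> by simp
    next
      case one
      then show ?thesis using k f by (simp add: bitvec_minus_eq_plus add.commute)
    qed
  qed
  have inspan: "f + c \<in> bitvec.span B \<longleftrightarrow> f \<in> bitvec.span B" if "c \<in> B" for f c
  proof
    have c: "c \<in> bitvec.span B" using that by (rule bitvec.span_base)
    show "f \<in> bitvec.span B" if "f + c \<in> bitvec.span B"
      using bitvec.span_diff[OF that c] by simp
    show "f + c \<in> bitvec.span B" if "f \<in> bitvec.span B"
      using bitvec.span_add[OF that c] .
  qed
  have finE: "finite (?E X Y)" if "finite X" "finite Y" for X Y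
    by (rule finite_subset[of _ "X \<times> Y"]) (use that in auto)
  have "?E F (insert b B) \<subseteq> ?E F0 B \<union> ?E F1 B
      \<union> ((\<lambda>f. (f, b)) ` {f \<in> F0. f + b \<in> F1} \<union> (\<lambda>f. (f, b)) ` {f \<in> F1. f + b \<in> F0})"
    (is "_ \<subseteq> ?new")
  proof (rule subrelI)
    fix f c
    assume fc: "(f, c) \<in> ?E F (insert b B)"
    show "(f, c) \<in> ?new"
    proof (cases "c \<in> B")
      case True
      then show ?thesis using fc inspan[OF True, of f] by (auto simp: F0_def F1_def)
    next
      case False
      with fc have [simp]: "c = b" by auto
      have "f \<in> F" "f + b \<in> F" using fc by auto
      moreover have "f + b \<in> bitvec.span B" if "f \<in> F1"
        using that G by (auto simp: G_def add.commute)
      ultimately have "f \<in> F0 \<and> f + b \<in> F1 \<or> f \<in> F1 \<and> f + b \<in> F0"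
        using toggle[of f] by (auto simp: F0_def F1_def)
      then show ?thesis by auto
    qed
  qed
  then have "card (?E F (insert b B)) \<le> card (?E F0 B \<union> ?E F1 B
      \<union> ((\<lambda>f. (f, b)) ` {f \<in> F0. f + b \<in> F1} \<union> (\<lambda>f. (f, b)) ` {f \<in> F1. f + b \<in> F0}))"
    using fin insert.hyps finE by (intro card_mono finite_UnI finite_imageI) auto
  also have "\<dots> \<le> card (?E F0 B) + card (?E F1 B)
      + (card {f \<in> F0. f + b \<in> F1} + card {f \<in> F1. f + b \<in> F0})"
    by (intro order_trans[OF card_Un_le] add_mono order_refl)
       (auto simp: card_image inj_on_def)
  also have "card (?E F1 B) \<le> card (?E G B)"
    by (rule card_inj_on_le[where f = "\<lambda>(f, c). (b + f, c)"])
       (use finE[OF fin(3) insert.hyps(1)] in \<open>auto simp: inj_on_def G_def add.assoc\<close>)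
  also have "card {f \<in> F0. f + b \<in> F1} \<le> min (card F0) (card F1)"
    by (intro min.boundedI card_mono card_inj_on_le[where f = "\<lambda>f. f + b" and B = F1])
       (use fin in \<open>auto simp: inj_on_def\<close>)
  also have "card {f \<in> F1. f + b \<in> F0} \<le> min (card F0) (card F1)"
    by (intro min.boundedI card_mono card_inj_on_le[where f = "\<lambda>f. f + b" and B = F0])
       (use fin in \<open>auto simp: inj_on_def\<close>)
  finally have "card (?E F (insert b B))
      \<le> card (?E F0 B) + card (?E G B) + 2 * min (card F0) (card F1)"
    by linarith
  then have "real (card (?E F (insert b B)))
      \<le> real (card (?E F0 B) + card (?E G B) + 2 * min (card F0) (card F1))"
    by (rule of_nat_mono)
  also have "\<dots> = real (card (?E F0 B)) + real (card (?E G B)) + 2 * min (card F0) (card F1)"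
    by (simp only: of_nat_add)
  also have "real (card (?E F0 B)) \<le> card F0 * log 2 (card F0)"
    by (rule insert.IH[OF ind fin(1)]) (simp add: F0_def)
  also have "real (card (?E G B)) \<le> card F1 * log 2 (card F1)"
    using insert.IH[OF ind fin(3) G] unfolding cardG .
  also have "card F0 * log 2 (card F0) + card F1 * log 2 (card F1) + 2 * min (card F0) (card F1)
      \<le> card F * log 2 (card F)"
    using entropy_ineq[of "card F0" "card F1"] F fin by (simp add: card_Un_disjoint)
  finally show ?case by linarith
qed

text \<open>
A set of large rank has a large sumset.  Every element of \<open>K\<close> has \<open>card B\<close> neighbours in the cube spanned by
\<open>B\<close>, all of them in \<open>K + B\<close>, so \<open>K \<union> (K + B)\<close> contains at least \<open>card K * card B\<close> ordered edges, while
edge isoperimetry limits their number.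
\<close>

lemma rank_doubling:
  assumes K: "finite K" "K \<noteq> {}" and B: "B \<subseteq> K" "bitvec.independent B" "K \<subseteq> bitvec.span B"
  shows "real (card K) * card B \<le> 2 * card (K + K) * log 2 (2 * card (K + K))"
proof -
  define F where "F = K \<union> (K + B)"
  have "finite B" using K(1) B(1) by (rule finite_subset[rotated])
  then have fin: "finite B" "finite F"
    using K by (simp_all add: F_def)
  have F: "F \<subseteq> bitvec.span B"
  proof -
    have "a + b \<in> bitvec.span B" if "a \<in> K" "b \<in> B" for a b
      using bitvec.span_add[OF subsetD[OF B(3) that(1)] bitvec.span_base[OF that(2)]] .
    then show ?thesis using B by (auto simp: F_def set_plus_def)
  qed
  have "card F \<le> card K + card (K + B)"
    unfolding F_def by (rule card_Un_le)
  also have "card (K + B) \<le> card (K + K)"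
    using K B(1) by (intro card_mono set_plus_mono2) auto
  also have "card K \<le> card (K + K)"
    using K by (intro card_sumset_ge)
  finally have cF: "card F \<le> 2 * card (K + K)" by simp
  have posF: "card F > 0"
    using fin K by (auto simp: card_gt_0_iff F_def)
  have "card K * card B = card (K \<times> B)"
    by (simp add: card_cartesian_product)
  also have "\<dots> \<le> card {(f, b). f \<in> F \<and> b \<in> B \<and> f + b \<in> F}"
  proof (rule card_mono)
    show "finite {(f, b). f \<in> F \<and> b \<in> B \<and> f + b \<in> F}"
      by (rule finite_subset[of _ "F \<times> B"]) (use fin in auto)
  qed (auto simp: F_def)
  also have "real \<dots> \<le> card F * log 2 (card F)"
    using fin B F by (intro edge_isoperimetry)
  also have "\<dots> \<le> (2 * card (K + K)) * log 2 (2 * card (K + K))"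
    using cF posF by (intro mult_mono log_mono) auto
  finally show ?thesis by simp
qed

section \<open>Counting skeletons\<close>

text \<open>
The elements of \<open>bs\<close> are chosen among \<open>2 ^ n\<close> vectors, those of \<open>xs\<close> only among at most \<open>2 ^ r\<close> vectors of
their span.  Lists of fixed length with possible repetitions make the number of descriptions a plain power.
\<close>

definition skeletons :: "nat \<Rightarrow> nat \<Rightarrow> nat \<Rightarrow> bitvec set set" where
  "skeletons n r t = {set bs \<union> set xs | bs xs.
     set bs \<subseteq> cube n \<and> length bs = r \<and> set xs \<subseteq> bitvec.span (set bs) \<and> length xs = t}"

lemma card_skeletons:
  shows "finite (skeletons n r t)" "card (skeletons n r t) \<le> 2 ^ (n * r + r * t)"
proof -
  let ?L = "\<lambda>k A. {xs. set xs \<subseteq> A \<and> length xs = k}"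
  let ?I = "SIGMA bs:?L r (cube n). ?L t (bitvec.span (set bs))"
  have eq: "skeletons n r t = (\<lambda>(bs, xs). set bs \<union> set xs) ` ?I"
    by (force simp: skeletons_def)
  have fin: "finite ?I"
    by (intro finite_SigmaI finite_lists_length_eq card_span_le) auto
  then show "finite (skeletons n r t)" by (simp add: eq)
  have "card (skeletons n r t) \<le> card ?I"
    unfolding eq using fin by (rule card_image_le)
  also have "\<dots> = (\<Sum>bs\<in>?L r (cube n). card (bitvec.span (set bs)) ^ t)"
    by (subst card_SigmaI) (auto simp: card_lists_length_eq card_span_le finite_lists_length_eq)
  also have "\<dots> \<le> (\<Sum>bs\<in>?L r (cube n). (2 ^ r) ^ t)"
  proof (intro sum_mono power_mono)
    fix bs assume "bs \<in> ?L r (cube n)"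
    then have "length bs = r" by simp
    have "card (bitvec.span (set bs)) \<le> 2 ^ card (set bs)"
      by (rule card_span_le) simp
    also have "\<dots> \<le> 2 ^ r"
      using card_length[of bs] \<open>length bs = r\<close> by (intro power_increasing) auto
    finally show "card (bitvec.span (set bs)) \<le> 2 ^ r" .
  qed simp
  also have "\<dots> = 2 ^ (n * r + r * t)"
    by (simp add: card_lists_length_eq card_cube power_mult power_add)
  finally show "card (skeletons n r t) \<le> 2 ^ (n * r + r * t)" .
qed

lemma padded_list_exists:
  assumes "finite A" "card A \<le> k"
  obtains xs where "A \<subseteq> set xs" "set xs \<subseteq> insert b A" "length xs = k"
proof -
  obtain ys where ys: "set ys = A" "length ys = card A"
    using assms finite_distinct_list[of A] distinct_card by metis
  show ?thesis
    by (rule that[of "ys @ replicate (k - card A) b"]) (use ys assms in auto)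
qed

text \<open>
The skeleton \<open>S\<close> grows from a basis of \<open>K\<close>, so that all further elements come from a space of
\<open>2 ^ r\<close> instead of \<open>2 ^ n\<close> vectors.  The claim holds for all large enough \<open>t\<close>, because in one
application \<open>t\<close> is chosen according to \<open>S + S\<close> and in the other according to \<open>K + K\<close>.
\<close>

lemma skeleton_exists:
  assumes K: "K \<subseteq> cube n" "2 \<le> card K"
  obtains S r where "S \<subseteq> K" "S \<noteq> {}" "K \<subseteq> popular S" "1 \<le> r" "r \<le> n"
    "\<And>t. 4 * card (S + S) \<le> t\<^sup>2 \<Longrightarrow> S \<in> skeletons n r t"
    "real (card K) * r \<le> 2 * card (K + K) * log 2 (2 * card (K + K))"
proof -
  have fK: "finite K" using K finite_subset finite_cube by blast
  obtain B where B: "B \<subseteq> K" "bitvec.independent B" "K \<subseteq> bitvec.span B"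
    using bitvec.maximal_independent_subset by blast
  have fB: "finite B" using B fK finite_subset by blast
  have Bne: "B \<noteq> {}"
  proof
    assume "B = {}"
    then have "K \<subseteq> {0}" using B by simp
    then have "card K \<le> 1" using card_mono[of "{0}" K] by simp
    then show False using K by simp
  qed
  obtain S where S: "B \<subseteq> S" "S \<subseteq> K" "(card S - card B)\<^sup>2 \<le> 4 * card (S + S)" "K \<subseteq> popular S"
    using greedy_skeleton[OF fK B(1) Bne] .
  have skel: "S \<in> skeletons n (card B) t" if t: "4 * card (S + S) \<le> t\<^sup>2" for t
  proof -
    have "card (S - B) \<le> t"
    proof -
      have "(card S - card B)\<^sup>2 \<le> t\<^sup>2" using S t by linarith
      then have "card S - card B \<le> t" by (simp add: power2_nat_le_eq_le)
      then show ?thesis using S fB by (simp add: card_Diff_subset)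
    qed
    moreover obtain b where b: "b \<in> B" using Bne by blast
    moreover have "S - B \<subseteq> bitvec.span B" using S B by blast
    moreover have "finite (S - B)" using S fK finite_subset by blast
    ultimately obtain xs where xs: "S - B \<subseteq> set xs" "set xs \<subseteq> insert b (S - B)" "length xs = t"
      by (rule_tac padded_list_exists[of "S - B" t b]) auto
    obtain bs where bs: "set bs = B" "length bs = card B"
      using fB finite_distinct_list[of B] distinct_card by metis
    have "set xs \<subseteq> S" using xs(2) b S(1) by blast
    moreover from this have "set xs \<subseteq> bitvec.span (set bs)"
      using S(2) B(3) bs(1) by blast
    ultimately have "S = set bs \<union> set xs" "set bs \<subseteq> cube n" "set xs \<subseteq> bitvec.span (set bs)"
      using xs(1) bs(1) S(1) B(1) K(1) by blast+
    then show ?thesis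
      using xs bs unfolding skeletons_def by blast
  qed
  have "real (card K) * card B \<le> 2 * card (K + K) * log 2 (2 * card (K + K))"
    using fK K B by (intro rank_doubling) auto
  moreover have "card B \<le> n"
    using B K by (intro independent_card_le) auto
  moreover have "1 \<le> card B"
    using fB Bne by (simp add: Suc_le_eq card_gt_0_iff)
  ultimately show ?thesis
    using that[of S "card B"] S Bne skel by blast
qed

lemma card_popular_subsets:
  fixes \<S> :: "'a::ab_group_add set set"
  assumes "finite \<S>" "\<And>S. S \<in> \<S> \<Longrightarrow> finite S \<and> S \<noteq> {} \<and> card (S + S) \<le> q"
  shows "finite {K. card K = m \<and> (\<exists>S\<in>\<S>. K \<subseteq> popular S)}"
    "card {K. card K = m \<and> (\<exists>S\<in>\<S>. K \<subseteq> popular S)} \<le> card \<S> * (2 * q choose m)"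
proof -
  let ?P = "\<lambda>S. {K. K \<subseteq> popular S \<and> card K = m}"
  have eq: "{K. card K = m \<and> (\<exists>S\<in>\<S>. K \<subseteq> popular S)} = (\<Union>S\<in>\<S>. ?P S)"
    by auto
  have fin: "finite (?P S)" if "S \<in> \<S>" for S
    using assms(2)[OF that] popular_bound(1)[of S] by simp
  show "finite {K. card K = m \<and> (\<exists>S\<in>\<S>. K \<subseteq> popular S)}"
    unfolding eq using assms fin by (intro finite_UN_I)
  have "card (\<Union>S\<in>\<S>. ?P S) \<le> (\<Sum>S\<in>\<S>. card (?P S))"
    using assms by (intro card_UN_le)
  also have "\<dots> \<le> (\<Sum>S\<in>\<S>. 2 * q choose m)"
  proof (rule sum_mono)
    fix S assume S: "S \<in> \<S>"
    have "card (?P S) = card (popular S) choose m"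
      using assms(2)[OF S] popular_bound(1)[of S] by (intro n_subsets) auto
    also have "\<dots> \<le> 2 * q choose m"
      using assms(2)[OF S] popular_bound(2)[of S] by (intro binomial_right_mono) auto
    finally show "card (?P S) \<le> 2 * q choose m" .
  qed
  finally show "card {K. card K = m \<and> (\<exists>S\<in>\<S>. K \<subseteq> popular S)} \<le> card \<S> * (2 * q choose m)"
    unfolding eq by simp
qed

section \<open>Union bound over witnesses\<close>

lemma sumset_cube: "X \<subseteq> cube n \<Longrightarrow> X + X \<subseteq> cube n"
  by (rule subsetI, elim set_plus_elim) (auto intro!: cube_add)

text \<open>
The union bound loses a factor of at most \<open>2 powr (q / 2)\<close>, while each \<open>X\<close> is a clique with probability
\<open>2 powr (1 - q)\<close>: the sum \<open>0\<close> is in \<open>X + X\<close>, but nothing is required of it.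
\<close>

lemma prob_sumset_family_le:
  assumes "finite \<X>" "\<And>X. X \<in> \<X> \<Longrightarrow> X \<subseteq> cube n \<and> X \<noteq> {} \<and> card (X + X) = q"
    and card: "card \<X> \<le> 2 powr (q / 2)"
  shows "measure_pmf.prob (random_subset (cube n)) {R. \<exists>X\<in>\<X>. X + X - {0} \<subseteq> R} \<le> 2 * 2 powr (- (real q) / 2)"
proof -
  have sub: "X + X - {0} \<subseteq> cube n" if "X \<in> \<X>" for X
    using assms(2)[OF that] sumset_cube[of X n] by blast
  have weight: "1 / 2 ^ card (X + X - {0}) = 2 * 2 powr (- real q)" if X: "X \<in> \<X>" for X
  proof -
    obtain x where x: "x \<in> X" using assms(2)[OF X] by blast
    then have zero: "0 \<in> X + X" using set_plus_intro[OF x x] by simp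
    have "finite X" using assms(2)[OF X] finite_subset[of X "cube n"] by simp
    then have "card (X + X) > 0" using zero by (auto simp: card_gt_0_iff)
    then have "q \<ge> 1" using assms(2)[OF X] by simp
    moreover have "card (X + X - {0}) = q - 1"
      using zero assms(2)[OF X] by (simp add: card_Diff_singleton)
    ultimately show ?thesis
      by (simp add: powr_minus powr_realpow power_diff field_simps)
  qed
  have "measure_pmf.prob (random_subset (cube n)) {R. \<exists>X\<in>\<X>. X + X - {0} \<subseteq> R}
      \<le> (\<Sum>X\<in>\<X>. 1 / 2 ^ card (X + X - {0}))"
    using assms(1) sub by (intro prob_some_superset_le) auto
  also have "\<dots> = (\<Sum>X\<in>\<X>. 2 * 2 powr (- real q))"
    using weight by (intro sum.cong) auto
  also have "\<dots> = card \<X> * (2 * 2 powr (- real q))" by simp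
  also have "\<dots> \<le> 2 powr (q / 2) * (2 * 2 powr (- real q))"
    using card by (intro mult_right_mono) auto
  also have "\<dots> = 2 * (2 powr (q / 2 + - real q))"
    by (simp only: powr_add mult_ac)
  also have "q / 2 + - real q = - (real q) / 2" by simp
  finally show ?thesis .
qed

lemma power_self_le_fact_exp: "real m ^ m \<le> fact m * exp (real m)"
proof -
  have "(\<Sum>k\<in>{m}. real m ^ k /\<^sub>R fact k) \<le> (\<Sum>k. real m ^ k /\<^sub>R fact k)"
    by (rule sum_le_suminf) (use exp_converges[of "real m"] in \<open>auto simp: sums_iff\<close>)
  also have "\<dots> = exp (real m)"
    using exp_converges[of "real m"] by (simp add: sums_iff)
  finally show ?thesis by (simp add: field_simps)
qed

text \<open>
With \<open>L = q / m\<close>, the standard estimate of the binomial coefficient gives \<open>m * log 2 (2 * exp 1 * L)\<close> bits, which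
is small compared with \<open>q = L * m\<close> once \<open>L\<close> is large.
\<close>

lemma binomial_le_powr:
  assumes "1 \<le> m" "2048 * m \<le> q"
  shows "real (2 * q choose m) \<le> 2 powr (q / 4)"
proof -
  define L where "L = real q / m"
  have m: "real m > 0" using assms by simp
  have L: "L \<ge> 2048" using assms m by (simp add: L_def le_divide_eq flip: of_nat_mult)
  have q: "real q = L * m" using m by (simp add: L_def)
  have "real (2 * q choose m) * fact m \<le> (2 * real q) ^ m"
    using of_nat_mono[OF binomial_fact_pow[of "2 * q" m], where 'a = real] by simp
  also have "\<dots> = (2 * L) ^ m * real m ^ m"
    by (simp add: q power_mult_distrib)
  also have "\<dots> \<le> (2 * L) ^ m * (fact m * exp (real m))"
    using L by (intro mult_left_mono power_self_le_fact_exp) auto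
  also have "\<dots> = (2 * L * exp 1) ^ m * fact m"
    using exp_of_nat_mult[of m "1::real"] by (simp add: power_mult_distrib)
  finally have "real (2 * q choose m) \<le> (2 * L * exp 1) ^ m"
    by (rule mult_right_le_imp_le) simp
  also have "\<dots> \<le> (2 powr (L / 4)) ^ m"
  proof (rule power_mono)
    have "2 * L * exp 1 \<le> 6 * L"
      using exp_le L by simp
    also have "6 * L \<le> 2 powr (L / 4)"
    proof -
      \<comment> \<open>The logarithm of \<open>x\<close> is at most \<open>2 * sqrt x\<close>, which is enough for these generous constants.\<close>
      have sq: "sqrt (6 * L) \<le> L / 12"
      proof (rule real_le_lsqrt)
        have "6 * L * 144 \<le> L * L" using L by (simp add: mult_right_mono)
        then show "6 * L \<le> (L / 12)\<^sup>2" by (simp add: power2_eq_square)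
      qed (use L in auto)
      have "ln (6 * L) = 2 * ln (sqrt (6 * L))"
        using L by (simp add: ln_sqrt)
      also have "\<dots> \<le> 2 * sqrt (6 * L)"
        using L ln_bound[of "sqrt (6 * L)"] by simp
      also have "\<dots> \<le> L / 4 * (2 / 3)" using sq by simp
      also have "\<dots> \<le> L / 4 * ln 2"
        using L ln2_ge_two_thirds by (intro mult_left_mono) auto
      finally have "exp (ln (6 * L)) \<le> exp (L / 4 * ln 2)" by simp
      then show ?thesis using L by (simp add: powr_def)
    qed
    finally show "2 * L * exp 1 \<le> 2 powr (L / 4)" .
  qed (use L in simp)
  also have "\<dots> = 2 powr (q / 4)"
    by (simp add: q powr_powr flip: powr_realpow)
  finally show ?thesis .
qed

text \<open>
The bound \<open>2 * sqrt q\<close> on the number of greedy steps, rounded up.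
\<close>

definition pad_length :: "nat \<Rightarrow> nat" where
  "pad_length q = nat \<lceil>2 * sqrt q\<rceil>"

lemma pad_length_ge: "4 * q \<le> (pad_length q)\<^sup>2"
proof -
  have "2 * sqrt q \<le> real (pad_length q)"
    unfolding pad_length_def by linarith
  then have "(2 * sqrt q)\<^sup>2 \<le> (real (pad_length q))\<^sup>2"
    by (intro power_mono) auto
  then have "real (4 * q) \<le> real ((pad_length q)\<^sup>2)" by (simp add: power_mult_distrib)
  then show ?thesis by (simp only: of_nat_le_iff)
qed

lemma pad_length_le:
  assumes "1 \<le> q"
  shows "real (pad_length q) \<le> 3 * sqrt q"
proof -
  have "0 \<le> 2 * sqrt q" by simp
  then have "real (pad_length q) \<le> 2 * sqrt q + 1"
    unfolding pad_length_def by linarith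
  moreover have "1 \<le> sqrt q" using assms by simp
  ultimately show ?thesis by linarith
qed

text \<open>
A skeleton costs \<open>n * r\<close> bits for the basis and \<open>r * pad_length q\<close> bits for the other elements; \<open>c\<close> says which
fraction of \<open>q\<close> each part may use.
\<close>

lemma skeleton_exponent:
  assumes "1 \<le> q" "c > 0" "c * (real n * r) \<le> q" "9 * c\<^sup>2 * (real r)\<^sup>2 \<le> q"
  shows "real (n * r + r * pad_length q) \<le> 2 * q / c"
proof -
  have "(3 * c * real r)\<^sup>2 \<le> q" using assms(4) by (simp add: power_mult_distrib)
  then have "3 * c * real r \<le> sqrt q" by (rule real_le_rsqrt)
  then have "(3 * c * real r) * sqrt q \<le> sqrt q * sqrt q"
    by (rule mult_right_mono) simp
  then have "c * (real r * (3 * sqrt q)) \<le> q" by (simp add: algebra_simps)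
  moreover have "c * (real r * real (pad_length q)) \<le> c * (real r * (3 * sqrt q))"
    using assms pad_length_le[OF assms(1)] by (intro mult_left_mono) auto
  ultimately have "c * (real n * r + real r * real (pad_length q)) \<le> 2 * q"
    using assms(3) by (simp add: distrib_left)
  then show ?thesis using assms(2) by (simp add: field_simps)
qed

text \<open>
The constants are generous.  The estimate of the binomial coefficient needs \<open>2048 * m \<le> q\<close>, and for rank \<open>r\<close>
the sumset size is only known to be at least \<open>m * r / (10 * lg)\<close>, hence the rank threshold \<open>20480 * lg\<close>.  A basis
of that rank costs \<open>20480 * n * lg\<close> bits, which has to be at most a quarter of \<open>m / 2\<close>; this leads to
\<open>200000\<close>.  The lower bound on \<open>n\<close> makes the square of the rank threshold small compared with \<open>n * lg\<close>.
\<close>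

context
  fixes n m :: nat and lg :: real
  assumes lg_ge: "1 \<le> lg" and n: "1000000 * lg \<le> n" and m: "200000 * (n * lg) \<le> m" "log 2 m \<le> 2 * lg"
begin

lemma n_lg_ge: "1000000 \<le> real n * lg"
proof -
  have "1000000 \<le> real n" using n lg_ge by linarith
  then show ?thesis using mult_mono[of 1000000 "real n" 1 lg] lg_ge by simp
qed

text \<open>
The basis costs \<open>n * r\<close> bits, of order \<open>n * lg\<close>, and \<open>q\<close> is a larger multiple of \<open>n * lg\<close>.  The other elements cost
\<open>r * sqrt q\<close> bits up to a constant, where \<open>r\<close> is only of order \<open>lg\<close>.
\<close>

lemma card_low_rank_skeletons:
  assumes r: "real r \<le> 20480 * lg" and q: "m \<le> 2 * q"
  shows "real (card (skeletons n r (pad_length q))) \<le> 2 powr (q / 2)"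
proof -
  have q': "100000 * (n * lg) \<le> q" using m(1) q by linarith
  then have q1: "1 \<le> q" using n_lg_ge by linarith
  have "real n * r \<le> n * (20480 * lg)"
    using r by (intro mult_left_mono) auto
  then have 1: "4 * (real n * r) \<le> q" using q' by linarith
  have "(real r)\<^sup>2 \<le> (20480 * lg)\<^sup>2"
    using r by (intro power_mono) auto
  also have "\<dots> = 419430400 * (lg * lg)" by (simp add: power2_eq_square)
  also have "\<dots> \<le> 419430400 * (lg * (n / 1000000))"
    using n lg_ge by (intro mult_left_mono) auto
  finally have 2: "9 * 4\<^sup>2 * (real r)\<^sup>2 \<le> q" using q' n_lg_ge by (simp add: mult.commute)
  have "real (card (skeletons n r (pad_length q))) \<le> 2 ^ (n * r + r * pad_length q)"
    using card_skeletons(2)[of n r "pad_length q"] of_nat_mono by fastforce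
  also have "\<dots> = 2 powr real (n * r + r * pad_length q)"
    by (subst powr_realpow) auto
  also have "\<dots> \<le> 2 powr (q / 2)"
    using skeleton_exponent[OF q1 _ 1 2] by simp
  finally show ?thesis .
qed

text \<open>
The bound on \<open>m * r\<close> makes \<open>q\<close> a large multiple both of \<open>m\<close>, because \<open>r\<close> is a large multiple of \<open>lg\<close>, and of
\<open>n * r\<close>, because \<open>m\<close> is a large multiple of \<open>n * lg\<close>.  The first fact bounds the choice of a set of popular
elements, the second one the choice of the skeleton.
\<close>

lemma card_high_rank_skeletons:
  assumes r: "20480 * lg < real r" "r \<le> n"
    and q: "real m * r \<le> 2 * q * log 2 (2 * q)" "m \<le> q" "q \<le> m\<^sup>2"
  shows "real (card (skeletons n r (pad_length q))) * (2 * q choose m) \<le> 2 powr (q / 2)"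
proof -
  have mpos: "1 \<le> m" using n_lg_ge m(1) by linarith
  have q1: "1 \<le> q" using mpos q by linarith
  have "log 2 (2 * q) \<le> log 2 (2 * (real m)\<^sup>2)"
    using q(3) q1 by (intro log_mono) (auto simp flip: of_nat_power)
  also have "\<dots> = 1 + 2 * log 2 m"
    using mpos by (simp add: log_mult log_nat_power)
  also have "\<dots> \<le> 5 * lg" using m(2) lg_ge by linarith
  finally have "2 * q * log 2 (2 * q) \<le> 2 * q * (5 * lg)"
    by (rule mult_left_mono) simp
  with q(1) have "real m * r \<le> real (2 * q) * (5 * lg)"
    by (simp only: of_nat_mult of_nat_numeral)
  then have mr: "real m * r \<le> 10 * (q * lg)" by simp
  have "2048 * m * (10 * lg) \<le> real m * r"
    using r(1) mpos by (simp add: mult_left_mono algebra_simps)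
  also have "\<dots> \<le> q * (10 * lg)" using mr by simp
  finally have "2048 * m \<le> q"
    using lg_ge by simp
  then have binom: "real (2 * q choose m) \<le> 2 powr (q / 4)"
    using mpos by (intro binomial_le_powr)
  have "(20000 * (real n * r)) * (10 * lg) = (200000 * (n * lg)) * r" by simp
  also have "\<dots> \<le> real m * r" using m(1) by (intro mult_right_mono) auto
  also have "\<dots> \<le> q * (10 * lg)" using mr by simp
  finally have qnr: "20000 * (real n * r) \<le> q"
    using lg_ge by simp
  have nr0: "0 \<le> real n * r" by simp
  have rr: "(real r)\<^sup>2 \<le> real n * r"
    using r(2) by (simp add: power2_eq_square mult_right_mono)
  have "real (card (skeletons n r (pad_length q))) \<le> 2 ^ (n * r + r * pad_length q)"
    using card_skeletons(2)[of n r "pad_length q"] of_nat_mono by fastforce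
  also have "\<dots> = 2 powr real (n * r + r * pad_length q)"
    by (subst powr_realpow) auto
  also have "\<dots> \<le> 2 powr (q / 4)"
  proof -
    have "8 * (real n * r) \<le> q" "576 * (real r)\<^sup>2 \<le> q"
      using qnr rr nr0 by linarith+
    then have "8 * (real n * r) \<le> q" "9 * 8\<^sup>2 * (real r)\<^sup>2 \<le> q"
      by simp_all
    from skeleton_exponent[OF q1 _ this] show ?thesis by simp
  qed
  finally have "real (card (skeletons n r (pad_length q))) * (2 * q choose m)
      \<le> 2 powr (q / 4) * 2 powr (q / 4)"
    using binom by (intro mult_mono) auto
  also have "\<dots> = 2 powr (q / 2)" by (simp flip: powr_add)
  finally show ?thesis .
qed

text \<open>
Skeletons of low rank are few enough for their own sumsets to decide.  For high rank, only the sumset of the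
whole set is known to be large enough, so the set has to be described too, through the popular elements.
\<close>

definition witnesses :: "nat \<Rightarrow> nat \<Rightarrow> bitvec set set" where
  "witnesses r q = {X. X \<subseteq> cube n \<and> X \<noteq> {} \<and> card (X + X) = q \<and>
     (if real r \<le> 20480 * lg then X \<in> skeletons n r (pad_length q)
      else card X = m \<and> (\<exists>S\<in>{S \<in> skeletons n r (pad_length q). finite S \<and> S \<noteq> {} \<and> card (S + S) \<le> q}.
        X \<subseteq> popular S))}"

text \<open>
What can be said about the rank of a set with \<open>m\<close> elements and the sumset size of its witness, independently of
the set.
\<close>

definition admissible :: "nat \<Rightarrow> nat \<Rightarrow> bool" where
  "admissible r q \<longleftrightarrow> m \<le> 2 * q \<and> (20480 * lg < real r \<longrightarrow>
     real m * r \<le> 2 * q * log 2 (2 * q) \<and> m \<le> q \<and> q \<le> m\<^sup>2)"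

lemma card_witnesses:
  assumes "admissible r q" "r \<le> n"
  shows "finite (witnesses r q)" "real (card (witnesses r q)) \<le> 2 powr (q / 2)"
proof -
  show "finite (witnesses r q)"
    by (rule finite_subset[of _ "Pow (cube n)"]) (auto simp: witnesses_def)
  show "real (card (witnesses r q)) \<le> 2 powr (q / 2)"
  proof (cases "real r \<le> 20480 * lg")
    case True
    then have "card (witnesses r q) \<le> card (skeletons n r (pad_length q))"
      by (intro card_mono card_skeletons(1)) (auto simp: witnesses_def)
    then have "real (card (witnesses r q)) \<le> real (card (skeletons n r (pad_length q)))"
      by simp
    also have "\<dots> \<le> 2 powr (q / 2)"
      using assms True by (intro card_low_rank_skeletons) (auto simp: admissible_def)
    finally show ?thesis .
  next
    case False
    let ?\<S> = "{S \<in> skeletons n r (pad_length q). finite S \<and> S \<noteq> {} \<and> card (S + S) \<le> q}"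
    have fin: "finite ?\<S>" using card_skeletons(1) by simp
    have "card (witnesses r q) \<le> card {X. card X = m \<and> (\<exists>S\<in>?\<S>. X \<subseteq> popular S)}"
    proof (rule card_mono)
      show "finite {X. card X = m \<and> (\<exists>S\<in>?\<S>. X \<subseteq> popular S)}"
        by (rule card_popular_subsets(1)[OF fin]) blast
    qed (use False in \<open>auto simp: witnesses_def\<close>)
    also have "\<dots> \<le> card ?\<S> * (2 * q choose m)"
      by (rule card_popular_subsets(2)[OF fin]) blast
    also have "\<dots> \<le> card (skeletons n r (pad_length q)) * (2 * q choose m)"
      using card_skeletons(1) by (intro mult_right_mono card_mono) auto
    finally have "real (card (witnesses r q))
        \<le> real (card (skeletons n r (pad_length q)) * (2 * q choose m))"
      by (rule of_nat_mono)
    also have "\<dots> \<le> 2 powr (q / 2)"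
      using assms False card_high_rank_skeletons[of r q] by (simp add: admissible_def)
    finally show ?thesis .
  qed
qed

text \<open>
Up to the rank threshold the skeleton is taken, whose sumset has at least \<open>m / 2\<close> elements because all \<open>m\<close>
elements of \<open>K\<close> are popular; above it, \<open>K\<close> itself.
\<close>

lemma clique_has_witness:
  assumes K: "K \<subseteq> cube n" "card K = m"
  obtains r q X where "r \<in> {1..n}" "q \<in> {..2 ^ n}" "admissible r q" "X \<in> witnesses r q" "X \<subseteq> K"
proof -
  have m2: "2 \<le> m" using m(1) n_lg_ge by linarith
  have fK: "finite K" using K finite_subset finite_cube by blast
  obtain S r where S: "S \<subseteq> K" "S \<noteq> {}" "K \<subseteq> popular S" and r: "1 \<le> r" "r \<le> n"
    and skel: "\<And>t. 4 * card (S + S) \<le> t\<^sup>2 \<Longrightarrow> S \<in> skeletons n r t"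
    and rank: "real (card K) * r \<le> 2 * card (K + K) * log 2 (2 * card (K + K))"
    using skeleton_exists[OF K(1)] K(2) m2 by blast
  have fS: "finite S" using S fK finite_subset by blast
  have in_cube: "card (X + X) \<le> 2 ^ n" if "X \<subseteq> K" for X
  proof -
    have "X + X \<subseteq> cube n" using that K(1) by (intro sumset_cube) blast
    then show ?thesis using card_cube[of n] card_mono[of "cube n" "X + X"] by simp
  qed
  have "m \<le> card (popular S)"
    using S(3) popular_bound(1)[OF fS S(2)] K(2) card_mono by blast
  also have "\<dots> \<le> 2 * card (S + S)" by (rule popular_bound(2)[OF fS S(2)])
  finally have mS: "m \<le> 2 * card (S + S)" .
  have SK: "card (S + S) \<le> card (K + K)"
    using S(1) fK by (intro card_mono set_plus_mono2) auto
  show ?thesis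
  proof (cases "real r \<le> 20480 * lg")
    case True
    show ?thesis
    proof (rule that[of r "card (S + S)" S])
      show "admissible r (card (S + S))" using True mS by (simp add: admissible_def)
      show "S \<in> witnesses r (card (S + S))"
        using True S K skel[OF pad_length_ge] by (auto simp: witnesses_def)
    qed (use r S in_cube in auto)
  next
    case False
    have "m \<le> card (K + K)" using card_sumset_ge[OF fK] K(2) by simp
    moreover have "card (K + K) \<le> m\<^sup>2"
      using card_sumset_le[OF fK fK] K(2) by (simp add: power2_eq_square)
    moreover have "S \<in> skeletons n r (pad_length (card (K + K)))"
      using skel[of "pad_length (card (K + K))"] pad_length_ge[of "card (K + K)"] SK by linarith
    ultimately show ?thesis
      using False S K SK rank fS r in_cube m2
      by (intro that[of r "card (K + K)" K]) (auto simp: witnesses_def admissible_def)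
  qed
qed

text \<open>
The union bound over the pairs \<open>(r, q)\<close> may be crude, since \<open>m / 4\<close> is much larger than \<open>n\<close>.
\<close>

lemma prob_large_clique_le:
  "measure_pmf.prob (random_subset (cube n)) {R. \<exists>K\<subseteq>cube n. card K = m \<and> K + K - {0} \<subseteq> R}
    \<le> real n * (2 ^ n + 1) * (2 * 2 powr (- real m / 4))"
proof -
  define J where "J = {(r, q). r \<in> {1..n} \<and> q \<in> {..2 ^ n} \<and> admissible r q}"
  let ?U = "\<lambda>(r, q). {R. \<exists>X\<in>witnesses r q. X + X - {0} \<subseteq> R}"
  have J: "J \<subseteq> {1..n} \<times> {..2 ^ n}" by (auto simp: J_def)
  then have finJ: "finite J" by (rule finite_subset) auto
  have "{R. \<exists>K\<subseteq>cube n. card K = m \<and> K + K - {0} \<subseteq> R} \<subseteq> (\<Union>rq\<in>J. ?U rq)"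
  proof
    fix R assume "R \<in> {R. \<exists>K\<subseteq>cube n. card K = m \<and> K + K - {0} \<subseteq> R}"
    then obtain K where K: "K \<subseteq> cube n" "card K = m" "K + K - {0} \<subseteq> R" by blast
    obtain r q X where *: "r \<in> {1..n}" "q \<in> {..2 ^ n}" "admissible r q" "X \<in> witnesses r q" "X \<subseteq> K"
      by (rule clique_has_witness[OF K(1,2)])
    have "X + X - {0} \<subseteq> R"
      using K(3) set_plus_mono2[OF *(5) *(5)] by blast
    then show "R \<in> (\<Union>rq\<in>J. ?U rq)"
      using * by (intro UN_I[of "(r, q)"]) (auto simp: J_def)
  qed
  then have "measure_pmf.prob (random_subset (cube n)) {R. \<exists>K\<subseteq>cube n. card K = m \<and> K + K - {0} \<subseteq> R}
      \<le> measure_pmf.prob (random_subset (cube n)) (\<Union>rq\<in>J. ?U rq)"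
    by (rule measure_pmf.finite_measure_mono) simp
  also have "\<dots> \<le> (\<Sum>rq\<in>J. measure_pmf.prob (random_subset (cube n)) (?U rq))"
    using finJ by (intro measure_pmf.finite_measure_subadditive_finite) auto
  also have "\<dots> \<le> (\<Sum>rq\<in>J. 2 * 2 powr (- real m / 4))"
  proof (rule sum_mono, clarify)
    fix r q assume rq: "(r, q) \<in> J"
    then have adm: "admissible r q" "r \<le> n" by (auto simp: J_def)
    have "measure_pmf.prob (random_subset (cube n)) {R. \<exists>X\<in>witnesses r q. X + X - {0} \<subseteq> R}
        \<le> 2 * 2 powr (- real q / 2)"
      by (rule prob_sumset_family_le[OF card_witnesses(1)[OF adm] _ card_witnesses(2)[OF adm]])
         (auto simp: witnesses_def)
    also have "\<dots> \<le> 2 * 2 powr (- real m / 4)"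
      using adm by (auto simp: admissible_def)
    finally show "measure_pmf.prob (random_subset (cube n)) {R. \<exists>X\<in>witnesses r q. X + X - {0} \<subseteq> R}
        \<le> 2 * 2 powr (- real m / 4)" .
  qed
  also have "\<dots> = card J * (2 * 2 powr (- real m / 4))" by simp
  also have "\<dots> \<le> real n * (2 ^ n + 1) * (2 * 2 powr (- real m / 4))"
  proof (rule mult_right_mono)
    have "card J \<le> n * (2 ^ n + 1)"
      using card_mono[OF _ J] by (simp add: card_cartesian_product)
    then have "real (card J) \<le> real (n * (2 ^ n + 1))" by (rule of_nat_mono)
    then show "real (card J) \<le> real n * (2 ^ n + 1)"
      by (simp only: of_nat_mult of_nat_add of_nat_power of_nat_numeral of_nat_1)
  qed simp
  finally show ?thesis .
qed

end

section \<open>The clique number in terms of sumsets\<close>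

text \<open>
Cliques are closed under subsets, so a bound on the clique number concerns sets of exactly one size.
\<close>

lemma le_clique_number_iff:
  assumes "finite V"
  shows "m \<le> clique_number V E \<longleftrightarrow> (\<exists>K\<subseteq>V. card K = m \<and> clique K E)"
proof -
  let ?C = "{card K | K. K \<subseteq> V \<and> clique K E}"
  have "?C = card ` {K \<in> Pow V. clique K E}" by blast
  then have fin: "finite ?C" using assms by simp
  have "card {} \<in> ?C" 
    by (intro CollectI exI[of _ "{}"]) (simp add: clique_def)
  then have ne: "?C \<noteq> {}" by blast
  show ?thesis
  proof
    assume m: "m \<le> clique_number V E"
    obtain K where K: "K \<subseteq> V" "clique K E" "card K = clique_number V E"
      using Max_in[OF fin ne] unfolding clique_number_def by auto
    then obtain L where L: "L \<subseteq> K" "card L = m"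
      using m by (metis obtain_subset_with_card_n)
    then have "clique L E" using K(2) unfolding clique_def by blast
    then show "\<exists>K\<subseteq>V. card K = m \<and> clique K E" using L K(1) by blast
  next
    assume "\<exists>K\<subseteq>V. card K = m \<and> clique K E"
    then have "m \<in> ?C" by blast
    then show "m \<le> clique_number V E"
      unfolding clique_number_def by (rule Max_ge[OF fin])
  qed
qed

definition to_Z2_pow :: "nat \<Rightarrow> bitvec \<Rightarrow> nat \<Rightarrow> int" where
  "to_Z2_pow n v = (\<lambda>i\<in>{..<n}. if v i = 1 then 1 else 0)"

lemma to_Z2_pow_bij: "bij_betw (to_Z2_pow n) (cube n) (carrier (Z2_pow n))"
proof (rule bij_betw_byWitness[where f' = "\<lambda>x i. if i < n \<and> x i = 1 then 1 else 0"])
  show "\<forall>v\<in>cube n. (\<lambda>i. if i < n \<and> to_Z2_pow n v i = 1 then 1 else 0) = v"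
    by (auto simp: to_Z2_pow_def cube_def fun_eq_iff)
  show "\<forall>x\<in>carrier (Z2_pow n). to_Z2_pow n (\<lambda>i. if i < n \<and> x i = 1 then 1 else 0) = x"
  proof (intro ballI ext)
    fix x i assume "x \<in> carrier (Z2_pow n)"
    then have x: "x \<in> {..<n} \<rightarrow>\<^sub>E {0..<2}"
      by (simp add: Z2_pow_def carrier_integer_mod_group)
    show "to_Z2_pow n (\<lambda>i. if i < n \<and> x i = 1 then 1 else 0) i = x i"
    proof (cases "i < n")
      case True
      then have "x i \<in> {0..<2}" using PiE_mem[OF x] by simp
      then have "x i = 0 \<or> x i = 1" by (simp, linarith)
      then show ?thesis using True by (auto simp: to_Z2_pow_def)
    next
      case False
      then show ?thesis using PiE_arb[OF x] by (simp add: to_Z2_pow_def)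
    qed
  qed
  show "to_Z2_pow n ` cube n \<subseteq> carrier (Z2_pow n)"
    by (simp add: to_Z2_pow_def Z2_pow_def carrier_integer_mod_group image_subset_iff restrict_PiE_iff)
  show "(\<lambda>x i. if i < n \<and> x i = 1 then 1 else 0) ` carrier (Z2_pow n) \<subseteq> cube n"
    by (auto simp: cube_def)
qed

lemma to_Z2_pow_add: "to_Z2_pow n u \<otimes>\<^bsub>Z2_pow n\<^esub> to_Z2_pow n v = to_Z2_pow n (u + v)"
proof
  fix i
  show "(to_Z2_pow n u \<otimes>\<^bsub>Z2_pow n\<^esub> to_Z2_pow n v) i = to_Z2_pow n (u + v) i"
    by (cases "u i"; cases "v i") (auto simp: Z2_pow_def to_Z2_pow_def)
qed

text \<open>
In characteristic two, \<open>u \<noteq> v\<close> means \<open>u + v \<noteq> 0\<close>, so only the sum \<open>0\<close> of equal elements is exempt.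
\<close>

lemma le_clique_number_Z2_pow_iff:
  assumes R: "R \<subseteq> cube n"
  shows "m \<le> clique_number (carrier (Z2_pow n)) (cayley_sum_edges (Z2_pow n) (to_Z2_pow n ` R))
    \<longleftrightarrow> (\<exists>K\<subseteq>cube n. card K = m \<and> K + K - {0} \<subseteq> R)"
proof -
  let ?h = "to_Z2_pow n"
  let ?E = "cayley_sum_edges (Z2_pow n) (?h ` R)"
  have inj: "inj_on ?h (cube n)" and img: "?h ` cube n = carrier (Z2_pow n)"
    using to_Z2_pow_bij by (auto simp: bij_betw_def)
  have clique_iff: "clique (?h ` K) ?E \<longleftrightarrow> K + K - {0} \<subseteq> R" if K: "K \<subseteq> cube n" for K
  proof -
    have in_R: "?h (u + v) \<in> ?h ` R \<longleftrightarrow> u + v \<in> R" if "u \<in> K" "v \<in> K" for u v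
    proof -
      have "u + v \<in> cube n" using that K by (intro cube_add) blast+
      then show ?thesis by (rule inj_on_image_mem_iff[OF inj _ R])
    qed
    have eq: "?h u = ?h v \<longleftrightarrow> u + v = 0" if "u \<in> K" "v \<in> K" for u v
    proof -
      have "?h u = ?h v \<longleftrightarrow> u = v" using that K by (intro inj_on_eq_iff[OF inj]) blast+
      then show ?thesis by (simp only: bitvec_add_eq_iff add_0)
    qed
    have "?h ` K \<subseteq> carrier (Z2_pow n)" using K img by blast
    then have "clique (?h ` K) ?E
        \<longleftrightarrow> (\<forall>u\<in>K. \<forall>v\<in>K. ?h u \<noteq> ?h v \<longrightarrow> ?h u \<otimes>\<^bsub>Z2_pow n\<^esub> ?h v \<in> ?h ` R)"
      by (simp only: clique_cayley_sum_edges_iff[OF comm_group_Z2_pow]) blast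
    also have "\<dots> \<longleftrightarrow> (\<forall>u\<in>K. \<forall>v\<in>K. u + v \<noteq> 0 \<longrightarrow> u + v \<in> R)"
      by (intro ball_cong refl) (simp only: to_Z2_pow_add in_R eq)
    also have "\<dots> \<longleftrightarrow> K + K - {0} \<subseteq> R"
      by (simp only: set_plus_def) blast
    finally show ?thesis .
  qed
  have "(\<exists>L\<subseteq>carrier (Z2_pow n). card L = m \<and> clique L ?E)
      \<longleftrightarrow> (\<exists>K\<subseteq>cube n. card (?h ` K) = m \<and> clique (?h ` K) ?E)"
    unfolding img[symmetric] by (auto simp: subset_image_iff)
  also have "\<dots> \<longleftrightarrow> (\<exists>K\<subseteq>cube n. card K = m \<and> K + K - {0} \<subseteq> R)"
    using clique_iff card_image[OF inj_on_subset[OF inj]] by metis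
  finally show ?thesis
    by (simp add: le_clique_number_iff[OF finite_carrier_Z2_pow])
qed

lemma random_subset_Z2_pow:
  "random_subset (carrier (Z2_pow n)) = map_pmf ((`) (to_Z2_pow n)) (random_subset (cube n))"
  unfolding random_subset_def
  by (rule map_pmf_of_set_bij_betw[symmetric])
     (auto intro: bij_betw_Pow to_Z2_pow_bij)

lemma prob_clique_number_bounds_ge:
  assumes "a \<le> real k" "real m \<le> b + 1"
    and A: "measure_pmf.prob (random_subset (cube n))
      {R. \<not> (\<exists>K\<subseteq>cube n. card K = k \<and> K + K - {0} \<subseteq> R)} \<le> \<epsilon>"
    and B: "measure_pmf.prob (random_subset (cube n))
      {R. \<exists>K\<subseteq>cube n. card K = m \<and> K + K - {0} \<subseteq> R} \<le> \<delta>"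
  shows "1 - (\<epsilon> + \<delta>) \<le> measure_pmf.prob (random_subset (carrier (Z2_pow n)))
      {A. let \<omega> = real (clique_number (carrier (Z2_pow n)) (cayley_sum_edges (Z2_pow n) A))
          in a \<le> \<omega> \<and> \<omega> \<le> b}"
proof -
  let ?M = "random_subset (cube n)"
  define \<omega> where "\<omega> R = clique_number (carrier (Z2_pow n))
    (cayley_sum_edges (Z2_pow n) (to_Z2_pow n ` R))" for R
  let ?good = "{R. a \<le> real (\<omega> R) \<and> real (\<omega> R) \<le> b}"
  let ?A = "{R. \<not> (\<exists>K\<subseteq>cube n. card K = k \<and> K + K - {0} \<subseteq> R)}"
  let ?B = "{R. \<exists>K\<subseteq>cube n. card K = m \<and> K + K - {0} \<subseteq> R}"
  have supp: "set_pmf ?M = Pow (cube n)"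
    by (simp add: random_subset_def set_pmf_of_set Pow_not_empty)
  have "- ?good \<inter> set_pmf ?M \<subseteq> ?A \<union> ?B"
  proof
    fix R assume "R \<in> - ?good \<inter> set_pmf ?M"
    then have R: "R \<subseteq> cube n" and bad: "\<not> (a \<le> real (\<omega> R) \<and> real (\<omega> R) \<le> b)"
      using supp by auto
    have "\<omega> R < k \<or> m \<le> \<omega> R"
    proof (rule ccontr)
      assume "\<not> (\<omega> R < k \<or> m \<le> \<omega> R)"
      then have "real k \<le> real (\<omega> R)" "real (\<omega> R) + 1 \<le> real m" by linarith+
      then show False using bad assms(1,2) by linarith
    qed
    then show "R \<in> ?A \<union> ?B"
      using le_clique_number_Z2_pow_iff[OF R, of k] le_clique_number_Z2_pow_iff[OF R, of m]
      unfolding \<omega>_def by auto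
  qed
  then have "measure_pmf.prob ?M (- ?good \<inter> set_pmf ?M) \<le> measure_pmf.prob ?M (?A \<union> ?B)"
    by (rule measure_pmf.finite_measure_mono) simp
  also have "\<dots> \<le> measure_pmf.prob ?M ?A + measure_pmf.prob ?M ?B"
    by (rule measure_Un_le) simp_all
  also have "\<dots> \<le> \<epsilon> + \<delta>" using A B by (rule add_mono)
  finally have "measure_pmf.prob ?M (- ?good) \<le> \<epsilon> + \<delta>"
    by (simp only: measure_Int_set_pmf)
  moreover have "measure_pmf.prob ?M (- ?good) = 1 - measure_pmf.prob ?M ?good"
    using measure_pmf.prob_compl[of ?good ?M] by (simp add: Compl_eq_Diff_UNIV)
  ultimately show ?thesis
    by (simp add: random_subset_Z2_pow \<omega>_def Let_def vimage_def)
qed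

section \<open>Asymptotics\<close>

lemma eventually_prob_no_large_clique:
  "\<forall>\<^sub>F n in sequentially. \<exists>k. 1 / 8 * real n * log 2 n \<le> real (2 ^ k) \<and>
     measure_pmf.prob (random_subset (cube n))
       {R. \<not> (\<exists>K\<subseteq>cube n. card K = 2 ^ k \<and> K + K - {0} \<subseteq> R)} \<le> n / 2 powr (n / 4 - 1)"
proof -
  have "\<forall>\<^sub>F n :: nat in sequentially. 0 < n" by (rule eventually_gt_at_top)
  moreover have "\<forall>\<^sub>F n :: nat in sequentially. 8 \<le> log 2 n" by real_asymp
  moreover have "\<forall>\<^sub>F n :: nat in sequentially. 8 * log 2 (n * log 2 n / 4) + 4 \<le> n" by real_asymp
  ultimately show ?thesis
  proof eventually_elim
    case (elim n)
    \<comment> \<open>The largest \<open>k\<close> with \<open>2 ^ k \<le> n * log 2 n / 4\<close>; since \<open>k\<close> exceeds \<open>log 2 n\<close>, this is below \<open>n * k / 4\<close>.\<close>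
    define x where "x = log 2 (n * log 2 n / 4)"
    define k where "k = nat \<lfloor>x\<rfloor>"
    have npos: "real n > 0" using elim(1) by simp
    have "log 2 n > 0" using elim(2) by linarith
    then have arg: "real n * log 2 n / 4 > 0" using npos by simp
    have two_x: "2 powr x = n * log 2 n / 4"
      using arg by (simp add: x_def)
    have "2 * real n \<le> n * log 2 n / 4"
      using mult_left_mono[OF elim(2), of "real n"] npos by simp
    then have "log 2 (2 * real n) \<le> x"
      unfolding x_def using npos by (intro log_mono) auto
    then have x: "1 + log 2 n \<le> x" using npos by (simp add: log_mult)
    then have x0: "0 \<le> x" using elim(2) by linarith
    then have k: "real k \<le> x" "x < real k + 1" unfolding k_def by linarith+
    have pk: "real (2 ^ k) = 2 powr real k" by (simp add: powr_realpow)
    have "2 powr x \<le> 2 powr (real k + 1)" using k by simp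
    then have low: "1 / 8 * real n * log 2 n \<le> real (2 ^ k)"
      using two_x pk by (simp add: powr_add)
    have "2 powr real k \<le> 2 powr x" using k by simp
    then have "4 * real (2 ^ k) \<le> n * log 2 n" using two_x pk by simp
    also have "\<dots> \<le> n * real k"
      using x k by (intro mult_left_mono) auto
    finally have "real (4 * 2 ^ k) \<le> real (n * k)" by simp
    then have c1: "4 * 2 ^ k \<le> n * k" by (simp only: of_nat_le_iff)
    have "real (8 * k + 4) \<le> real n"
      using elim(3) k(1) by (simp add: x_def)
    then have c2: "8 * k + 4 \<le> n" by (simp only: of_nat_le_iff)
    have "measure_pmf.prob (random_subset (cube n))
        {R. \<not> (\<exists>K\<subseteq>cube n. card K = 2 ^ k \<and> K + K - {0} \<subseteq> R)} \<le> k / 2 ^ (n div 4)"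
      using c2 by (intro prob_no_large_clique_le c1) auto
    also have "\<dots> \<le> n / 2 powr (n / 4 - 1)"
    proof (rule frac_le)
      have "real n / 4 - 1 \<le> real (n div 4)" by linarith
      then have "2 powr (n / 4 - 1) \<le> 2 powr real (n div 4)" by simp
      then show "2 powr (n / 4 - 1) \<le> 2 ^ (n div 4)" by (simp add: powr_realpow)
    qed (use c2 in auto)
    finally show ?case using low by blast
  qed
qed

lemma eventually_prob_large_clique:
  "\<forall>\<^sub>F n in sequentially. \<exists>m. real m \<le> 200000 * real n * log 2 n + 1 \<and>
     measure_pmf.prob (random_subset (cube n))
       {R. \<exists>K\<subseteq>cube n. card K = m \<and> K + K - {0} \<subseteq> R}
     \<le> real n * (2 ^ n + 1) * (2 * 2 powr (- 50000 * real n))"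
proof -
  have "\<forall>\<^sub>F n :: nat in sequentially. 0 < n" by (rule eventually_gt_at_top)
  moreover have "\<forall>\<^sub>F n :: nat in sequentially. 1 \<le> log 2 n" by real_asymp
  moreover have "\<forall>\<^sub>F n :: nat in sequentially. 1000000 * log 2 n \<le> n" by real_asymp
  moreover have "\<forall>\<^sub>F n :: nat in sequentially. 200000 * real n * log 2 n + 1 \<le> (real n)\<^sup>2" by real_asymp
  ultimately show ?thesis
  proof eventually_elim
    case (elim n)
    define x where "x = 200000 * (n * log 2 n)"
    define m where "m = nat \<lceil>x\<rceil>"
    have npos: "real n > 0" using elim(1) by simp
    have nx: "200000 * real n \<le> x"
      using mult_left_mono[OF elim(2), of "real n"] npos by (simp add: x_def)
    then have m: "x \<le> real m" "real m \<le> x + 1"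
      using npos unfolding m_def by linarith+
    have mpos: "real m > 0" using m nx npos by linarith
    have "real m \<le> (real n)\<^sup>2"
      using m(2) elim(4) unfolding x_def by linarith
    then have "log 2 m \<le> log 2 ((real n)\<^sup>2)"
      using mpos by (intro log_mono) auto
    also have "\<dots> = 2 * log 2 n" using npos by (simp add: log_nat_power)
    finally have "log 2 m \<le> 2 * log 2 n" .
    then have "measure_pmf.prob (random_subset (cube n))
        {R. \<exists>K\<subseteq>cube n. card K = m \<and> K + K - {0} \<subseteq> R}
        \<le> real n * (2 ^ n + 1) * (2 * 2 powr (- real m / 4))"
      using elim m(1) by (intro prob_large_clique_le[of "log 2 n"]) (auto simp: x_def)
    also have "\<dots> \<le> real n * (2 ^ n + 1) * (2 * 2 powr (- 50000 * real n))"
      using nx m by (intro mult_left_mono) auto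
    finally have "measure_pmf.prob (random_subset (cube n))
        {R. \<exists>K\<subseteq>cube n. card K = m \<and> K + K - {0} \<subseteq> R}
        \<le> real n * (2 ^ n + 1) * (2 * 2 powr (- 50000 * real n))" .
    moreover have "real m \<le> 200000 * real n * log 2 n + 1"
      using m(2) by (simp add: x_def)
    ultimately show ?case by blast
  qed
qed

theorem theorem9:
  shows "\<exists>C1 C2 :: real. C1 > 0 \<and> C2 > 0 \<and>
    (\<lambda>n. let N = (2 :: real) ^ n in
       measure_pmf.prob (random_subset (carrier (Z2_pow n)))
         {A. let \<omega> = real (clique_number (carrier (Z2_pow n)) (cayley_sum_edges (Z2_pow n) A)) in
             C1 * log 2 N * log 2 (log 2 N) \<le> \<omega> \<and>
             \<omega> \<le> C2 * log 2 N * log 2 (log 2 N)})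
    \<longlonglongrightarrow> 1"
proof (intro exI conjI)
  let ?P = "\<lambda>n. measure_pmf.prob (random_subset (carrier (Z2_pow n)))
    {A. let \<omega> = real (clique_number (carrier (Z2_pow n)) (cayley_sum_edges (Z2_pow n) A)) in
       1 / 8 * real n * log 2 n \<le> \<omega> \<and> \<omega> \<le> 200000 * real n * log 2 n}"
  let ?\<epsilon> = "\<lambda>n :: nat. n / 2 powr (n / 4 - 1)"
  let ?\<delta> = "\<lambda>n :: nat. real n * (2 ^ n + 1) * (2 * 2 powr (- 50000 * real n))"
  have log_N: "log 2 ((2 :: real) ^ n) = real n" for n
    by (simp add: log_nat_power)
  have "?P \<longlonglongrightarrow> 1"
  proof (rule tendsto_sandwich)
    show "\<forall>\<^sub>F n in sequentially. 1 - (?\<epsilon> n + ?\<delta> n) \<le> ?P n"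
      using eventually_prob_no_large_clique eventually_prob_large_clique
    proof eventually_elim
      case (elim n)
      then show ?case using prob_clique_number_bounds_ge by blast
    qed
    show "\<forall>\<^sub>F n in sequentially. ?P n \<le> 1"
      by simp
    show "(\<lambda>n. 1 - (?\<epsilon> n + ?\<delta> n)) \<longlonglongrightarrow> 1"
      by real_asymp
  qed simp
  then show "(\<lambda>n. let N = (2 :: real) ^ n in
       measure_pmf.prob (random_subset (carrier (Z2_pow n)))
         {A. let \<omega> = real (clique_number (carrier (Z2_pow n)) (cayley_sum_edges (Z2_pow n) A)) in
             1 / 8 * log 2 N * log 2 (log 2 N) \<le> \<omega> \<and>
             \<omega> \<le> 200000 * log 2 N * log 2 (log 2 N)})
    \<longlonglongrightarrow> 1"
    by (simp only: Let_def log_N)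
qed simp_all

end
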